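(* Let $R$ be a commutative ring, $M$ a finitely generated flat $R$-module, and $R\rightarrow S$ an injective homomorphism of commutative rings. Then $M$ is a projective $R$-module if and only if $M\otimes_{R}S$ is a projective $S$-module.
   Context: All rings are commutative (with identity), and ring maps are unital. *)

theory Defs
  imports "HOL-Algebra.Module" "HOL-Algebra.RingHom" "HOL-Algebra.Free_Abelian_Groups"
begin

definition mod_hom ::
  "('a, 'r) ring_scheme \<Rightarrow> ('a, 'm) module \<Rightarrow> ('a, 'n) module \<Rightarrow> ('m \<Rightarrow> 'n) set"
  where "mod_hom R M N =
    {f \<in> carrier M \<rightarrow> carrier N.
       (\<forall>x\<in>carrier M. \<forall>y\<in>carrier M. f (x \<oplus>\<^bsub>M\<^esub> y) = f x \<oplus>\<^bsub>N\<^esub> f y) \<and>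
       (\<forall>r\<in>carrier R. \<forall>x\<in>carrier M. f (r \<odot>\<^bsub>M\<^esub> x) = r \<odot>\<^bsub>N\<^esub> f x)}"

definition finitely_generated_module :: "('a, 'r) ring_scheme \<Rightarrow> ('a, 'm) module \<Rightarrow> bool"
  where "finitely_generated_module R M \<longleftrightarrow>
    (\<exists>X. finite X \<and> X \<subseteq> carrier M \<and>
       (\<forall>y\<in>carrier M. \<exists>c \<in> X \<rightarrow> carrier R. y = (\<Oplus>\<^bsub>M\<^esub>x\<in>X. c x \<odot>\<^bsub>M\<^esub> x)))"

definition lifts_through ::
  "('a, 'r) ring_scheme \<Rightarrow> ('a, 'm) module \<Rightarrow> ('a, 'n) module \<Rightarrow> ('a, 'p) module \<Rightarrow> bool"
  where "lifts_through R M N P \<longleftrightarrow>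
    (\<forall>g \<in> mod_hom R N P. \<forall>f \<in> mod_hom R M P. g ` carrier N = carrier P \<longrightarrow>
       (\<exists>l \<in> mod_hom R M N. \<forall>x\<in>carrier M. g (l x) = f x))"

text \<open>
  A definition in HOL cannot quantify over the types of \<open>N\<close> and \<open>P\<close>.  The types chosen here are
  large enough to contain the canonical presentation of \<open>M\<close> by the free module on its own
  elements; \<open>projective_module_lifts\<close> below shows that lifts then exist for \<open>N\<close> and \<open>P\<close> of
  arbitrary types.
\<close>

definition projective_module :: "('a, 'r) ring_scheme \<Rightarrow> ('a, 'm) module \<Rightarrow> bool"
  where "projective_module R M \<longleftrightarrow> module R M \<and>
    (\<forall>(N :: ('a, 'm \<Rightarrow> 'a) module) (P :: ('a, 'm) module).
       module R N \<longrightarrow> module R P \<longrightarrow> lifts_through R M N P)"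

text \<open>
  The tensor product is the free abelian group on the pairs modulo the bilinearity relations, so
  its elements are cosets of \<open>tensor_kernel\<close>.
\<close>

abbreviation pair_group ::
  "('a, 'm) module \<Rightarrow> ('a, 'n) module \<Rightarrow> ('m \<times> 'n \<Rightarrow>\<^sub>0 int) monoid"
  where "pair_group M N \<equiv> free_Abelian_group (carrier M \<times> carrier N)"

definition tensor_relations ::
  "('a, 'r) ring_scheme \<Rightarrow> ('a, 'm) module \<Rightarrow> ('a, 'n) module \<Rightarrow> ('m \<times> 'n \<Rightarrow>\<^sub>0 int) set"
  where "tensor_relations R M N =
      {frag_of (x \<oplus>\<^bsub>M\<^esub> x', y) - frag_of (x, y) - frag_of (x', y) | x x' y.
         x \<in> carrier M \<and> x' \<in> carrier M \<and> y \<in> carrier N}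
    \<union> {frag_of (x, y \<oplus>\<^bsub>N\<^esub> y') - frag_of (x, y) - frag_of (x, y') | x y y'.
         x \<in> carrier M \<and> y \<in> carrier N \<and> y' \<in> carrier N}
    \<union> {frag_of (r \<odot>\<^bsub>M\<^esub> x, y) - frag_of (x, r \<odot>\<^bsub>N\<^esub> y) | r x y.
         r \<in> carrier R \<and> x \<in> carrier M \<and> y \<in> carrier N}"

definition tensor_kernel ::
  "('a, 'r) ring_scheme \<Rightarrow> ('a, 'm) module \<Rightarrow> ('a, 'n) module \<Rightarrow> ('m \<times> 'n \<Rightarrow>\<^sub>0 int) set"
  where "tensor_kernel R M N = generate (pair_group M N) (tensor_relations R M N)"

text \<open>
  \<open>tensor_map R M N f g\<close> is \<open>f \<otimes> g\<close>, where \<open>M\<close> and \<open>N\<close> are the codomains of \<open>f\<close> and \<open>g\<close>; see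
  \<open>tensor_map_coset\<close> below for its value on the coset of a given representative.
\<close>

definition tensor_map ::
  "('a, 'r) ring_scheme \<Rightarrow> ('a, 'm) module \<Rightarrow> ('a, 'n) module \<Rightarrow> ('u \<Rightarrow> 'm) \<Rightarrow> ('v \<Rightarrow> 'n) \<Rightarrow>
     ('u \<times> 'v \<Rightarrow>\<^sub>0 int) set \<Rightarrow> ('m \<times> 'n \<Rightarrow>\<^sub>0 int) set"
  where "tensor_map R M N f g X =
    (\<Union>x\<in>X. tensor_kernel R M N #>\<^bsub>pair_group M N\<^esub> frag_extend (\<lambda>(u, v). frag_of (f u, g v)) x)"

text \<open>
  The library's module records extend ring records; the multiplication of a record used as a
  module is irrelevant.
\<close>

definition tensor_module ::
  "('a, 'r) ring_scheme \<Rightarrow> ('a, 'm) module \<Rightarrow> ('a, 'n) module \<Rightarrow>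
     ('a, ('m \<times> 'n \<Rightarrow>\<^sub>0 int) set) module"
  where "tensor_module R M N =
    \<lparr>carrier = carrier (pair_group M N Mod tensor_kernel R M N),
     monoid.mult = undefined, one = undefined,
     ring.zero = \<one>\<^bsub>pair_group M N Mod tensor_kernel R M N\<^esub>,
     add = (\<otimes>\<^bsub>pair_group M N Mod tensor_kernel R M N\<^esub>),
     smult = (\<lambda>r. tensor_map R M N (\<lambda>x. r \<odot>\<^bsub>M\<^esub> x) id)\<rparr>"

definition restricted_ring ::
  "('s, 't) ring_scheme \<Rightarrow> ('a \<Rightarrow> 's) \<Rightarrow> ('a, 's) module"
  where "restricted_ring S h =
    \<lparr>carrier = carrier S, monoid.mult = (\<otimes>\<^bsub>S\<^esub>), one = \<one>\<^bsub>S\<^esub>, ring.zero = \<zero>\<^bsub>S\<^esub>, add = (\<oplus>\<^bsub>S\<^esub>),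
     smult = (\<lambda>r s. h r \<otimes>\<^bsub>S\<^esub> s)\<rparr>"

text \<open>
  \<open>M \<otimes>\<^sub>R S\<close> as an \<open>S\<close>-module, \<open>S\<close> acting on the second factor.
\<close>

definition base_change ::
  "('a, 'r) ring_scheme \<Rightarrow> ('a, 'm) module \<Rightarrow> ('s, 't) ring_scheme \<Rightarrow> ('a \<Rightarrow> 's) \<Rightarrow>
     ('s, ('m \<times> 's \<Rightarrow>\<^sub>0 int) set) module"
  where "base_change R M S h = (let T = tensor_module R M (restricted_ring S h) in
    \<lparr>carrier = carrier T, monoid.mult = undefined, one = undefined,
     ring.zero = \<zero>\<^bsub>T\<^esub>, add = (\<oplus>\<^bsub>T\<^esub>),
     smult = (\<lambda>s. tensor_map R M (restricted_ring S h) id (\<lambda>t. s \<otimes>\<^bsub>S\<^esub> t))\<rparr>)"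

definition tensor_preserves_inj ::
  "('a, 'r) ring_scheme \<Rightarrow> ('a, 'm) module \<Rightarrow> ('a, 'n) module \<Rightarrow> ('a, 'p) module \<Rightarrow> bool"
  where "tensor_preserves_inj R M N P \<longleftrightarrow>
    (\<forall>f \<in> mod_hom R N P. inj_on f (carrier N) \<longrightarrow>
       inj_on (tensor_map R M P id f) (carrier (tensor_module R M N)))"

text \<open>
  Again the types of \<open>N\<close> and \<open>P\<close> have to be fixed.  Functions on the natural numbers suffice, as
  they accommodate the submodules of free modules of finite rank; \<open>flat_module_preserves_inj\<close>
  below gives the property for \<open>N\<close> and \<open>P\<close> of arbitrary types.
\<close>

definition flat_module :: "('a, 'r) ring_scheme \<Rightarrow> ('a, 'm) module \<Rightarrow> bool"
  where "flat_module R M \<longleftrightarrow> module R M \<and>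
    (\<forall>(N :: ('a, nat \<Rightarrow> 'a) module) (P :: ('a, nat \<Rightarrow> 'a) module).
       module R N \<longrightarrow> module R P \<longrightarrow> tensor_preserves_inj R M N P)"

lemma mod_homD:
  assumes "f \<in> mod_hom R M N"
  shows "x \<in> carrier M \<Longrightarrow> f x \<in> carrier N"
    and "x \<in> carrier M \<Longrightarrow> y \<in> carrier M \<Longrightarrow> f (x \<oplus>\<^bsub>M\<^esub> y) = f x \<oplus>\<^bsub>N\<^esub> f y"
    and "r \<in> carrier R \<Longrightarrow> x \<in> carrier M \<Longrightarrow> f (r \<odot>\<^bsub>M\<^esub> x) = r \<odot>\<^bsub>N\<^esub> f x"
  using assms by (auto simp: mod_hom_def)

lemma mod_hom_id: "id \<in> mod_hom R M M"
  by (simp add: mod_hom_def)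

lemma subgroup_free_Abelian_groupD:
  assumes "subgroup K (free_Abelian_group A)"
  shows "k \<in> K \<Longrightarrow> Poly_Mapping.keys k \<subseteq> A" "0 \<in> K"
    "k \<in> K \<Longrightarrow> l \<in> K \<Longrightarrow> k + l \<in> K" "k \<in> K \<Longrightarrow> - k \<in> K"
    "k \<in> K \<Longrightarrow> l \<in> K \<Longrightarrow> k - l \<in> K"
proof -
  show *: "k \<in> K \<Longrightarrow> Poly_Mapping.keys k \<subseteq> A" for k
    using subgroup.mem_carrier[OF assms] by auto
  show "0 \<in> K" using subgroup.one_closed[OF assms] by simp
  show **: "k \<in> K \<Longrightarrow> l \<in> K \<Longrightarrow> k + l \<in> K" for k l
    using subgroup.m_closed[OF assms] by simp
  show ***: "k \<in> K \<Longrightarrow> - k \<in> K" for k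
    using subgroup.m_inv_closed[OF assms, of k] * by simp
  show "k \<in> K \<Longrightarrow> l \<in> K \<Longrightarrow> k - l \<in> K"
    using **[of k "-l"] *** by simp
qed

lemma mem_coset_free_Abelian_group:
  "z \<in> K #>\<^bsub>free_Abelian_group A\<^esub> x \<longleftrightarrow> z - x \<in> K"
  by (auto simp: r_coset_def algebra_simps) (metis diff_add_cancel)

lemma coset_eq_free_Abelian_group:
  assumes "subgroup K (free_Abelian_group A)"
  shows "K #>\<^bsub>free_Abelian_group A\<^esub> x = K #>\<^bsub>free_Abelian_group B\<^esub> y \<longleftrightarrow> x - y \<in> K"
proof
  assume "K #>\<^bsub>free_Abelian_group A\<^esub> x = K #>\<^bsub>free_Abelian_group B\<^esub> y"
  moreover have "x \<in> K #>\<^bsub>free_Abelian_group A\<^esub> x"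
    using subgroup_free_Abelian_groupD[OF assms] by (simp add: mem_coset_free_Abelian_group)
  ultimately show "x - y \<in> K" by (simp add: mem_coset_free_Abelian_group)
next
  assume *: "x - y \<in> K"
  have "z - x \<in> K \<longleftrightarrow> z - y \<in> K" for z
    using subgroup_free_Abelian_groupD(3)[OF assms, OF _ *, of "z - x"]
      subgroup_free_Abelian_groupD(5)[OF assms, OF _ *, of "z - y"] by auto
  then show "K #>\<^bsub>free_Abelian_group A\<^esub> x = K #>\<^bsub>free_Abelian_group B\<^esub> y"
    by (auto simp: mem_coset_free_Abelian_group)
qed

lemma frag_extend_diff_mem:
  assumes K: "subgroup K (free_Abelian_group B)"
    and g: "\<And>p. p \<in> A \<Longrightarrow> g p - h p \<in> K" and x: "Poly_Mapping.keys x \<subseteq> A"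
  shows "frag_extend g x - frag_extend h x \<in> K"
  using x
proof (induction x rule: frag_induction)
  case zero then show ?case using subgroup_free_Abelian_groupD[OF K] by simp
next
  case (one x) then show ?case using g by simp
next
  case (diff a b)
  have "frag_extend g (a - b) - frag_extend h (a - b) =
     (frag_extend g a - frag_extend h a) - (frag_extend g b - frag_extend h b)"
    by (simp add: frag_extend_diff)
  with diff show ?case using subgroup_free_Abelian_groupD(5)[OF K] by metis
qed

lemma frag_extend_mem:
  assumes K: "subgroup K (free_Abelian_group B)"
    and g: "\<And>p. p \<in> A \<Longrightarrow> g p \<in> K" and x: "Poly_Mapping.keys x \<subseteq> A"
  shows "frag_extend g x \<in> K"
  using frag_extend_diff_mem[OF K, of A g "\<lambda>_. 0" x] g x by (simp add: frag_extend_eq_0)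

lemma frag_extend_generate_mem:
  assumes G: "G \<subseteq> carrier (free_Abelian_group A)" and K: "subgroup K (free_Abelian_group B)"
    and g: "\<And>r. r \<in> G \<Longrightarrow> frag_extend f r \<in> K"
    and x: "x \<in> generate (free_Abelian_group A) G"
  shows "frag_extend f x \<in> K"
  using x
proof (induction x rule: generate.induct)
  case one then show ?case using subgroup_free_Abelian_groupD[OF K] by simp
next
  case (incl h) then show ?case by (rule g)
next
  case (inv h)
  then have "inv\<^bsub>free_Abelian_group A\<^esub> h = - h" using subsetD[OF G inv] by simp
  then show ?case using g[OF inv] subgroup_free_Abelian_groupD[OF K] by (simp add: frag_extend_minus)
next
  case (eng h1 h2)
  then show ?case using subgroup_free_Abelian_groupD[OF K] by (simp add: frag_extend_add)
qed

lemma keys_tensor_relations: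
  assumes "module R M" "module R N"
  shows "tensor_relations R M N \<subseteq> carrier (pair_group M N)"
proof -
  interpret M: module R M by fact
  interpret N: module R N by fact
  show ?thesis
    unfolding tensor_relations_def
    by (auto simp: keys_frag_of split: if_splits dest!: subsetD[OF keys_diff])
qed

lemma subgroup_tensor_kernel:
  assumes "module R M" "module R N"
  shows "subgroup (tensor_kernel R M N) (pair_group M N)"
  unfolding tensor_kernel_def
  by (rule group.generate_is_subgroup[OF group_free_Abelian_group keys_tensor_relations[OF assms]])

lemma tensor_kernel_rel:
  assumes "module R M" "module R N"
  shows "x \<in> carrier M \<Longrightarrow> x' \<in> carrier M \<Longrightarrow> y \<in> carrier N \<Longrightarrow>
       frag_of (x \<oplus>\<^bsub>M\<^esub> x', y) - frag_of (x, y) - frag_of (x', y) \<in> tensor_kernel R M N"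
    and "x \<in> carrier M \<Longrightarrow> y \<in> carrier N \<Longrightarrow> y' \<in> carrier N \<Longrightarrow>
       frag_of (x, y \<oplus>\<^bsub>N\<^esub> y') - frag_of (x, y) - frag_of (x, y') \<in> tensor_kernel R M N"
    and "r \<in> carrier R \<Longrightarrow> x \<in> carrier M \<Longrightarrow> y \<in> carrier N \<Longrightarrow>
       frag_of (r \<odot>\<^bsub>M\<^esub> x, y) - frag_of (x, r \<odot>\<^bsub>N\<^esub> y) \<in> tensor_kernel R M N"
  unfolding tensor_kernel_def
  by (auto simp: tensor_relations_def intro!: generate.incl)

lemma tensor_kernel_hom:
  assumes M: "module R M'" "module R N'" "module R M" "module R N"
    and f: "f \<in> mod_hom R M' M" and g: "g \<in> mod_hom R N' N"
    and x: "x \<in> tensor_kernel R M' N'"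
  shows "frag_extend (\<lambda>(u, v). frag_of (f u, g v)) x \<in> tensor_kernel R M N"
proof (rule frag_extend_generate_mem[OF keys_tensor_relations[OF M(1,2)] subgroup_tensor_kernel[OF M(3,4)]])
  show "x \<in> generate (pair_group M' N') (tensor_relations R M' N')"
    using x by (simp add: tensor_kernel_def)
  fix r assume "r \<in> tensor_relations R M' N'"
  then show "frag_extend (\<lambda>(u, v). frag_of (f u, g v)) r \<in> tensor_kernel R M N"
    unfolding tensor_relations_def
    by (auto simp: frag_extend_diff mod_homD[OF f] mod_homD[OF g] intro!: tensor_kernel_rel[OF M(3,4)])
qed

lemma Union_cosets:
  assumes K: "subgroup K (free_Abelian_group B)"
    and L: "subgroup L (free_Abelian_group A)"
    and g: "\<And>k. k \<in> L \<Longrightarrow> frag_extend f k \<in> K"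
  shows "(\<Union>z \<in> L #>\<^bsub>free_Abelian_group A\<^esub> x. K #>\<^bsub>free_Abelian_group B\<^esub> frag_extend f z)
     = K #>\<^bsub>free_Abelian_group B\<^esub> frag_extend f x"
proof -
  have "K #>\<^bsub>free_Abelian_group B\<^esub> frag_extend f z = K #>\<^bsub>free_Abelian_group B\<^esub> frag_extend f x"
    if "z \<in> L #>\<^bsub>free_Abelian_group A\<^esub> x" for z
    using that g[of "z - x"]
    by (simp add: coset_eq_free_Abelian_group[OF K] mem_coset_free_Abelian_group frag_extend_diff)
  moreover have "x \<in> L #>\<^bsub>free_Abelian_group A\<^esub> x"
    using subgroup_free_Abelian_groupD[OF L] by (simp add: mem_coset_free_Abelian_group)
  ultimately show ?thesis by blast
qed

lemma tensor_map_coset: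
  assumes M: "module R M'" "module R N'" "module R M" "module R N"
    and f: "f \<in> mod_hom R M' M" and g: "g \<in> mod_hom R N' N"
  shows "tensor_map R M N f g (tensor_kernel R M' N' #>\<^bsub>pair_group M' N'\<^esub> x) =
     tensor_kernel R M N #>\<^bsub>pair_group M N\<^esub> frag_extend (\<lambda>(u, v). frag_of (f u, g v)) x"
  unfolding tensor_map_def
  by (rule Union_cosets[OF subgroup_tensor_kernel[OF M(3,4)] subgroup_tensor_kernel[OF M(1,2)]
      tensor_kernel_hom[OF assms]])

lemma quotient_module:
  assumes Q: "cring Q" and K: "subgroup K (free_Abelian_group A)"
    and T: "carrier T = carrier (free_Abelian_group A Mod K)"
      "\<zero>\<^bsub>T\<^esub> = \<one>\<^bsub>free_Abelian_group A Mod K\<^esub>"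
      "\<And>X Y. X \<oplus>\<^bsub>T\<^esub> Y = X \<otimes>\<^bsub>free_Abelian_group A Mod K\<^esub> Y"
    and T_smult: "\<And>r x. r \<in> carrier Q \<Longrightarrow> r \<odot>\<^bsub>T\<^esub> (K #>\<^bsub>free_Abelian_group A\<^esub> x) =
        K #>\<^bsub>free_Abelian_group A\<^esub> frag_extend (\<lambda>p. frag_of (\<phi> r p)) x"
    and \<phi>: "\<And>r p. r \<in> carrier Q \<Longrightarrow> p \<in> A \<Longrightarrow> \<phi> r p \<in> A"
      "\<And>r s p. r \<in> carrier Q \<Longrightarrow> s \<in> carrier Q \<Longrightarrow> p \<in> A \<Longrightarrow>
         frag_of (\<phi> (r \<oplus>\<^bsub>Q\<^esub> s) p) - frag_of (\<phi> r p) - frag_of (\<phi> s p) \<in> K"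
      "\<And>r s p. r \<in> carrier Q \<Longrightarrow> s \<in> carrier Q \<Longrightarrow> p \<in> A \<Longrightarrow> \<phi> (r \<otimes>\<^bsub>Q\<^esub> s) p = \<phi> r (\<phi> s p)"
      "\<And>p. p \<in> A \<Longrightarrow> \<phi> \<one>\<^bsub>Q\<^esub> p = p"
  shows "module Q T"
proof -
  let ?F = "free_Abelian_group A"
  interpret F: comm_group ?F by (rule abelian_free_Abelian_group)
  interpret Kn: normal K ?F by (rule F.subgroup_imp_normal[OF K])
  interpret FK: comm_group "?F Mod K" by (rule F.abelian_FactGroup[OF K])
  have car: "carrier T = (\<lambda>x. K #>\<^bsub>?F\<^esub> x) ` {x. Poly_Mapping.keys x \<subseteq> A}"
    by (auto simp: T carrier_FactGroup)
  have add: "(K #>\<^bsub>?F\<^esub> x) \<oplus>\<^bsub>T\<^esub> (K #>\<^bsub>?F\<^esub> y) = K #>\<^bsub>?F\<^esub> (x + y)"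
    if "Poly_Mapping.keys x \<subseteq> A" "Poly_Mapping.keys y \<subseteq> A" for x y
    using Kn.rcos_sum[of x y] that by (simp add: T)
  have kl: "Poly_Mapping.keys (frag_extend (\<lambda>p. frag_of (\<phi> r p)) x) \<subseteq> A"
    if "Poly_Mapping.keys x \<subseteq> A" "r \<in> carrier Q" for x r
  proof
    fix q assume "q \<in> Poly_Mapping.keys (frag_extend (\<lambda>p. frag_of (\<phi> r p)) x)"
    then obtain p where "p \<in> Poly_Mapping.keys x" "q = \<phi> r p"
      using keys_frag_extend[of "\<lambda>p. frag_of (\<phi> r p)" x] by (auto simp: keys_frag_of)
    then show "q \<in> A" using that \<phi>(1)[of r p] by blast
  qed
  have ag: "abelian_group T"
  proof (rule abelian_groupI)
    fix x assume "x \<in> carrier T"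
    then show "\<exists>y\<in>carrier T. y \<oplus>\<^bsub>T\<^esub> x = \<zero>\<^bsub>T\<^esub>"
      unfolding T using FK.l_inv_ex by blast
  qed (use FK.m_closed FK.one_closed FK.m_assoc FK.m_comm FK.l_one in \<open>simp_all only: T\<close>)
  show ?thesis
  proof (rule moduleI[OF Q ag])
    fix r x assume "r \<in> carrier Q" "x \<in> carrier T"
    then show "r \<odot>\<^bsub>T\<^esub> x \<in> carrier T" unfolding car using kl by (auto simp: T_smult)
  next
    fix r s x assume rs: "r \<in> carrier Q" "s \<in> carrier Q" and "x \<in> carrier T"
    then obtain z where z: "Poly_Mapping.keys z \<subseteq> A" "x = K #>\<^bsub>?F\<^esub> z" unfolding car by blast
    have "frag_extend (\<lambda>p. frag_of (\<phi> (r \<oplus>\<^bsub>Q\<^esub> s) p)) z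
       - frag_extend (\<lambda>p. frag_of (\<phi> r p) + frag_of (\<phi> s p)) z \<in> K"
      by (rule frag_extend_diff_mem[OF K _ z(1)]) (use \<phi>(2)[OF rs] in \<open>simp add: algebra_simps\<close>)
    moreover have "frag_extend (\<lambda>p. frag_of (\<phi> r p) + frag_of (\<phi> s p)) z
      = frag_extend (\<lambda>p. frag_of (\<phi> r p)) z + frag_extend (\<lambda>p. frag_of (\<phi> s p)) z"
      by (simp add: frag_extend_def frag_cmul_distrib2 sum.distrib)
    ultimately show "(r \<oplus>\<^bsub>Q\<^esub> s) \<odot>\<^bsub>T\<^esub> x = r \<odot>\<^bsub>T\<^esub> x \<oplus>\<^bsub>T\<^esub> s \<odot>\<^bsub>T\<^esub> x"
      using rs Q kl[OF z(1)]
      by (simp add: z(2) T_smult add coset_eq_free_Abelian_group[OF K] cring.cring_simprules)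
    have "frag_extend (\<lambda>p. frag_of (\<phi> (r \<otimes>\<^bsub>Q\<^esub> s) p)) z
      = frag_extend (\<lambda>p. frag_of (\<phi> r (\<phi> s p))) z"
      using z \<phi>(3)[OF rs] by (intro frag_extend_eq) auto
    also have "\<dots> = frag_extend (\<lambda>p. frag_of (\<phi> r p)) (frag_extend (\<lambda>p. frag_of (\<phi> s p)) z)"
      using frag_extend_compose[of "\<lambda>p. frag_of (\<phi> r p)" "\<phi> s"] by (simp add: o_def fun_eq_iff)
    finally show "(r \<otimes>\<^bsub>Q\<^esub> s) \<odot>\<^bsub>T\<^esub> x = r \<odot>\<^bsub>T\<^esub> (s \<odot>\<^bsub>T\<^esub> x)"
      using rs Q by (simp add: z(2) T_smult cring.cring_simprules)
  next
    fix r x y assume r: "r \<in> carrier Q" and "x \<in> carrier T" "y \<in> carrier T"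
    then obtain u v where "Poly_Mapping.keys u \<subseteq> A" "x = K #>\<^bsub>?F\<^esub> u"
      "Poly_Mapping.keys v \<subseteq> A" "y = K #>\<^bsub>?F\<^esub> v" unfolding car by blast
    then show "r \<odot>\<^bsub>T\<^esub> (x \<oplus>\<^bsub>T\<^esub> y) = r \<odot>\<^bsub>T\<^esub> x \<oplus>\<^bsub>T\<^esub> r \<odot>\<^bsub>T\<^esub> y"
      using r kl by (simp add: add T_smult frag_extend_add)
  next
    fix x assume "x \<in> carrier T"
    then obtain z where z: "Poly_Mapping.keys z \<subseteq> A" "x = K #>\<^bsub>?F\<^esub> z" unfolding car by blast
    have "frag_extend (\<lambda>p. frag_of (\<phi> \<one>\<^bsub>Q\<^esub> p)) z = frag_extend frag_of z"
      using z \<phi>(4) by (intro frag_extend_eq) auto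
    then show "\<one>\<^bsub>Q\<^esub> \<odot>\<^bsub>T\<^esub> x = x"
      using Q by (simp add: z(2) T_smult cring.cring_simprules flip: frag_expansion)
  qed
qed

lemma smult_mod_hom:
  assumes "module R M" "r \<in> carrier R"
  shows "(\<lambda>x. r \<odot>\<^bsub>M\<^esub> x) \<in> mod_hom R M M"
proof -
  interpret module R M by fact
  show ?thesis using assms(2)
    by (auto simp: mod_hom_def smult_r_distr smult_assoc1[symmetric] R.m_comm)
qed

lemma module_tensor_module:
  assumes "module R M" "module R N"
  shows "module R (tensor_module R M N)"
proof -
  interpret M: module R M by fact
  interpret N: module R N by fact
  show ?thesis
  proof (rule quotient_module[OF M.R.is_cring subgroup_tensor_kernel[OF assms],
        where \<phi> = "\<lambda>r (x, y). (r \<odot>\<^bsub>M\<^esub> x, y)"])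
    fix r x assume "r \<in> carrier R"
    then show "r \<odot>\<^bsub>tensor_module R M N\<^esub> (tensor_kernel R M N #>\<^bsub>pair_group M N\<^esub> x)
      = tensor_kernel R M N #>\<^bsub>pair_group M N\<^esub>
          frag_extend (\<lambda>p. frag_of (case p of (x, y) \<Rightarrow> (r \<odot>\<^bsub>M\<^esub> x, y))) x"
      using tensor_map_coset[OF assms assms smult_mod_hom[OF assms(1)] mod_hom_id, of r x]
      by (simp add: tensor_module_def case_prod_unfold)
  next
    fix r s p assume "r \<in> carrier R" "s \<in> carrier R" "p \<in> carrier M \<times> carrier N"
    then show "frag_of (case p of (x, y) \<Rightarrow> ((r \<oplus>\<^bsub>R\<^esub> s) \<odot>\<^bsub>M\<^esub> x, y))
       - frag_of (case p of (x, y) \<Rightarrow> (r \<odot>\<^bsub>M\<^esub> x, y))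
       - frag_of (case p of (x, y) \<Rightarrow> (s \<odot>\<^bsub>M\<^esub> x, y)) \<in> tensor_kernel R M N"
      by (auto simp: M.smult_l_distr intro!: tensor_kernel_rel[OF assms])
  qed (auto simp: tensor_module_def M.smult_assoc1)
qed

lemma module_restricted_ring:
  assumes "cring R" "cring S" "h \<in> ring_hom R S"
  shows "module R (restricted_ring S h)"
proof -
  interpret R: cring R by fact
  interpret S: cring S by fact
  have "abelian_group (restricted_ring S h)"
    by (rule abelian_groupI)
      (auto simp: restricted_ring_def S.a_assoc intro: S.a_comm S.add.l_inv_ex)
  then show ?thesis
    using assms(3)
    by (intro moduleI assms(1))
      (auto simp: restricted_ring_def ring_hom_closed ring_hom_add ring_hom_mult ring_hom_one
        S.l_distr S.r_distr S.m_assoc)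
qed

lemma module_base_change:
  assumes "module R M" "cring S" "h \<in> ring_hom R S"
  shows "module S (base_change R M S h)"
proof -
  interpret M: module R M by fact
  interpret S: cring S by fact
  let ?N = "restricted_ring S h"
  have N: "module R ?N" by (rule module_restricted_ring[OF M.R.is_cring assms(2,3)])
  have car: "carrier ?N = carrier S" by (simp add: restricted_ring_def)
  have hom: "(\<lambda>t. s \<otimes>\<^bsub>S\<^esub> t) \<in> mod_hom R ?N ?N" if "s \<in> carrier S" for s
    using that assms(3)
    by (auto simp: mod_hom_def restricted_ring_def S.r_distr ring_hom_closed S.m_lcomm)
  show ?thesis
  proof (rule quotient_module[OF assms(2) subgroup_tensor_kernel[OF assms(1) N],
        where \<phi> = "\<lambda>s (x, t). (x, s \<otimes>\<^bsub>S\<^esub> t)"])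
    fix s x assume "s \<in> carrier S"
    then show "s \<odot>\<^bsub>base_change R M S h\<^esub> (tensor_kernel R M ?N #>\<^bsub>pair_group M ?N\<^esub> x)
      = tensor_kernel R M ?N #>\<^bsub>pair_group M ?N\<^esub>
          frag_extend (\<lambda>p. frag_of (case p of (x, t) \<Rightarrow> (x, s \<otimes>\<^bsub>S\<^esub> t))) x"
      using tensor_map_coset[OF assms(1) N assms(1) N mod_hom_id hom, of s x]
      by (simp add: base_change_def Let_def case_prod_unfold)
  next
    fix r s p assume "r \<in> carrier S" "s \<in> carrier S" "p \<in> carrier M \<times> carrier ?N"
    then show "frag_of (case p of (x, t) \<Rightarrow> (x, (r \<oplus>\<^bsub>S\<^esub> s) \<otimes>\<^bsub>S\<^esub> t))
       - frag_of (case p of (x, t) \<Rightarrow> (x, r \<otimes>\<^bsub>S\<^esub> t))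
       - frag_of (case p of (x, t) \<Rightarrow> (x, s \<otimes>\<^bsub>S\<^esub> t)) \<in> tensor_kernel R M ?N"
      using tensor_kernel_rel(2)[OF assms(1) N, of "fst p" "r \<otimes>\<^bsub>S\<^esub> snd p" "s \<otimes>\<^bsub>S\<^esub> snd p"]
      by (auto simp: car S.l_distr) (simp add: restricted_ring_def)
  qed (auto simp: base_change_def Let_def tensor_module_def car S.m_assoc)
qed

definition free_mod :: "('a, 'r) ring_scheme \<Rightarrow> 'i set \<Rightarrow> ('a, 'i \<Rightarrow> 'a) module"
  where "free_mod R I =
    \<lparr>carrier = {v. (\<forall>i\<in>I. v i \<in> carrier R) \<and> (\<forall>i. i \<notin> I \<longrightarrow> v i = \<zero>\<^bsub>R\<^esub>) \<and> finite {i. v i \<noteq> \<zero>\<^bsub>R\<^esub>}},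
     monoid.mult = undefined, one = undefined,
     ring.zero = (\<lambda>_. \<zero>\<^bsub>R\<^esub>), add = (\<lambda>v w i. v i \<oplus>\<^bsub>R\<^esub> w i), smult = (\<lambda>r v i. r \<otimes>\<^bsub>R\<^esub> v i)\<rparr>"

definition free_unit :: "('a, 'r) ring_scheme \<Rightarrow> 'i \<Rightarrow> 'i \<Rightarrow> 'a"
  where "free_unit R i = (\<lambda>j. if j = i then \<one>\<^bsub>R\<^esub> else \<zero>\<^bsub>R\<^esub>)"

definition free_eval ::
  "('a, 'r) ring_scheme \<Rightarrow> ('a, 'n) module \<Rightarrow> ('i \<Rightarrow> 'n) \<Rightarrow> ('i \<Rightarrow> 'a) \<Rightarrow> 'n"
  where "free_eval R N p v = (\<Oplus>\<^bsub>N\<^esub>i\<in>{i. v i \<noteq> \<zero>\<^bsub>R\<^esub>}. v i \<odot>\<^bsub>N\<^esub> p i)"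

lemma free_mod_car:
  assumes "cring R" "v \<in> carrier (free_mod R I)"
  shows "v i \<in> carrier R" "finite {i. v i \<noteq> \<zero>\<^bsub>R\<^esub>}" "v i \<noteq> \<zero>\<^bsub>R\<^esub> \<Longrightarrow> i \<in> I"
proof -
  interpret cring R by fact
  show "v i \<in> carrier R" using assms(2) by (cases "i \<in> I") (auto simp: free_mod_def)
qed (use assms(2) in \<open>auto simp: free_mod_def\<close>)

lemma module_free_mod:
  assumes "cring R" shows "module R (free_mod R I)"
proof -
  interpret R: cring R by fact
  have fin: "finite {i. v i \<oplus>\<^bsub>R\<^esub> w i \<noteq> \<zero>\<^bsub>R\<^esub>}"
    if "finite {i. v i \<noteq> \<zero>\<^bsub>R\<^esub>}" "finite {i. w i \<noteq> \<zero>\<^bsub>R\<^esub>}" for v w :: "'c \<Rightarrow> 'a"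
    by (rule finite_subset[OF _ finite_UnI[OF that]]) auto
  have fin2: "finite {i. r \<otimes>\<^bsub>R\<^esub> v i \<noteq> \<zero>\<^bsub>R\<^esub>}"
    if "finite {i. v i \<noteq> \<zero>\<^bsub>R\<^esub>}" "r \<in> carrier R" for r and v :: "'c \<Rightarrow> 'a"
    by (rule finite_subset[OF _ that(1)]) (use that(2) in auto)
  note c = free_mod_car(1)[OF assms]
  have ag: "abelian_group (free_mod R I)"
  proof (rule abelian_groupI)
    fix v assume v: "v \<in> carrier (free_mod R I)"
    then have "{i. \<ominus>\<^bsub>R\<^esub> v i \<noteq> \<zero>\<^bsub>R\<^esub>} \<subseteq> {i. v i \<noteq> \<zero>\<^bsub>R\<^esub>}" by auto
    then have "finite {i. \<ominus>\<^bsub>R\<^esub> v i \<noteq> \<zero>\<^bsub>R\<^esub>}"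
      by (rule finite_subset) (use free_mod_car(2)[OF assms v] in simp)
    then have "(\<lambda>i. \<ominus>\<^bsub>R\<^esub> v i) \<in> carrier (free_mod R I)"
      using v by (auto simp: free_mod_def)
    moreover have "(\<lambda>i. \<ominus>\<^bsub>R\<^esub> v i) \<oplus>\<^bsub>free_mod R I\<^esub> v = \<zero>\<^bsub>free_mod R I\<^esub>"
      using c[OF v] by (simp add: free_mod_def R.l_neg)
    ultimately show "\<exists>w\<in>carrier (free_mod R I). w \<oplus>\<^bsub>free_mod R I\<^esub> v = \<zero>\<^bsub>free_mod R I\<^esub>"
      by blast
  next
    fix u v w assume *: "u \<in> carrier (free_mod R I)" "v \<in> carrier (free_mod R I)" "w \<in> carrier (free_mod R I)"
    show "u \<oplus>\<^bsub>free_mod R I\<^esub> v \<oplus>\<^bsub>free_mod R I\<^esub> w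
       = u \<oplus>\<^bsub>free_mod R I\<^esub> (v \<oplus>\<^bsub>free_mod R I\<^esub> w)"
      using *[THEN c] by (simp add: free_mod_def R.a_assoc)
  next
    fix u v assume *: "u \<in> carrier (free_mod R I)" "v \<in> carrier (free_mod R I)"
    show "u \<oplus>\<^bsub>free_mod R I\<^esub> v = v \<oplus>\<^bsub>free_mod R I\<^esub> u"
      using *[THEN c] by (simp add: free_mod_def R.a_comm)
    show "u \<oplus>\<^bsub>free_mod R I\<^esub> v \<in> carrier (free_mod R I)"
      using * fin by (auto simp: free_mod_def)
  next
    fix u assume "u \<in> carrier (free_mod R I)"
    from this[THEN c] show "\<zero>\<^bsub>free_mod R I\<^esub> \<oplus>\<^bsub>free_mod R I\<^esub> u = u"
      by (simp add: free_mod_def)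
  next
    show "\<zero>\<^bsub>free_mod R I\<^esub> \<in> carrier (free_mod R I)"
      by (simp add: free_mod_def)
  qed
  show ?thesis
  proof (rule moduleI[OF assms ag])
    fix r s u assume *: "r \<in> carrier R" "s \<in> carrier R" "u \<in> carrier (free_mod R I)"
    note u = *(3)[THEN c]
    show "(r \<oplus>\<^bsub>R\<^esub> s) \<odot>\<^bsub>free_mod R I\<^esub> u = r \<odot>\<^bsub>free_mod R I\<^esub> u \<oplus>\<^bsub>free_mod R I\<^esub> s \<odot>\<^bsub>free_mod R I\<^esub> u"
      using *(1,2) u by (simp add: free_mod_def R.l_distr)
    show "(r \<otimes>\<^bsub>R\<^esub> s) \<odot>\<^bsub>free_mod R I\<^esub> u = r \<odot>\<^bsub>free_mod R I\<^esub> (s \<odot>\<^bsub>free_mod R I\<^esub> u)"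
      using *(1,2) u by (simp add: free_mod_def R.m_assoc)
  next
    fix r u v assume *: "r \<in> carrier R" "u \<in> carrier (free_mod R I)" "v \<in> carrier (free_mod R I)"
    show "r \<odot>\<^bsub>free_mod R I\<^esub> (u \<oplus>\<^bsub>free_mod R I\<^esub> v)
       = r \<odot>\<^bsub>free_mod R I\<^esub> u \<oplus>\<^bsub>free_mod R I\<^esub> r \<odot>\<^bsub>free_mod R I\<^esub> v"
      using *(1) *(2,3)[THEN c] by (simp add: free_mod_def R.r_distr)
  next
    fix r u assume *: "r \<in> carrier R" "u \<in> carrier (free_mod R I)"
    show "r \<odot>\<^bsub>free_mod R I\<^esub> u \<in> carrier (free_mod R I)"
      using * fin2 by (auto simp: free_mod_def)
  next
    fix u assume "u \<in> carrier (free_mod R I)"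
    from this[THEN c] show "\<one>\<^bsub>R\<^esub> \<odot>\<^bsub>free_mod R I\<^esub> u = u"
      by (simp add: free_mod_def)
  qed
qed

lemma free_unit_mem:
  assumes "cring R" "i \<in> I"
  shows "free_unit R i \<in> carrier (free_mod R I)"
proof -
  interpret R: cring R by fact
  have "finite {j. free_unit R i j \<noteq> \<zero>\<^bsub>R\<^esub>}"
    by (rule finite_subset[of _ "{i}"]) (auto simp: free_unit_def)
  then show ?thesis using assms(2) by (auto simp: free_mod_def free_unit_def)
qed

lemma free_eval_superset:
  assumes "module R N" "v \<in> carrier (free_mod R I)" "p \<in> I \<rightarrow> carrier N"
    and A: "finite A" "A \<subseteq> I" "{i. v i \<noteq> \<zero>\<^bsub>R\<^esub>} \<subseteq> A"
  shows "free_eval R N p v = (\<Oplus>\<^bsub>N\<^esub>i\<in>A. v i \<odot>\<^bsub>N\<^esub> p i)"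
proof -
  interpret N: module R N by fact
  have "v i \<in> carrier R" for i by (rule free_mod_car(1)[OF N.R.is_cring assms(2)])
  then show ?thesis
    unfolding free_eval_def using assms(3) A
    by (intro N.M.add.finprod_mono_neutral_cong_left) (auto simp: Pi_iff)
qed

lemma free_eval_hom:
  assumes "module R N" "p \<in> I \<rightarrow> carrier N"
  shows "free_eval R N p \<in> mod_hom R (free_mod R I) N"
proof -
  interpret N: module R N by fact
  interpret F: module R "free_mod R I" by (rule module_free_mod[OF N.R.is_cring])
  note c = free_mod_car[OF N.R.is_cring]
  note sup = free_eval_superset[OF assms(1) _ assms(2)]
  have closed: "v i \<odot>\<^bsub>N\<^esub> p i \<in> carrier N" if "v \<in> carrier (free_mod R I)" "i \<in> I" for v i
    using c(1)[OF that(1)] assms(2) that(2) by auto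
  show ?thesis unfolding mod_hom_def
  proof (intro CollectI conjI ballI funcsetI)
    fix v assume v: "v \<in> carrier (free_mod R I)"
    show "free_eval R N p v \<in> carrier N"
      unfolding free_eval_def using closed[OF v] c(3)[OF v] by (intro N.M.finsum_closed) auto
  next
    fix v w assume v: "v \<in> carrier (free_mod R I)" and w: "w \<in> carrier (free_mod R I)"
    let ?A = "{i. v i \<noteq> \<zero>\<^bsub>R\<^esub>} \<union> {i. w i \<noteq> \<zero>\<^bsub>R\<^esub>}"
    have A: "finite ?A" "?A \<subseteq> I" using c(2,3)[OF v] c(2,3)[OF w] by auto
    have vw: "v \<oplus>\<^bsub>free_mod R I\<^esub> w = (\<lambda>i. v i \<oplus>\<^bsub>R\<^esub> w i)" by (simp add: free_mod_def)
    have "free_eval R N p (v \<oplus>\<^bsub>free_mod R I\<^esub> w)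
        = (\<Oplus>\<^bsub>N\<^esub>i\<in>?A. (v i \<oplus>\<^bsub>R\<^esub> w i) \<odot>\<^bsub>N\<^esub> p i)"
      unfolding vw by (rule sup[OF F.M.a_closed[OF v w, unfolded vw] A]) auto
    also have "\<dots> = (\<Oplus>\<^bsub>N\<^esub>i\<in>?A. v i \<odot>\<^bsub>N\<^esub> p i \<oplus>\<^bsub>N\<^esub> w i \<odot>\<^bsub>N\<^esub> p i)"
      using A(2) closed[OF v] closed[OF w] c(1)[OF v] c(1)[OF w] assms(2)
      by (intro N.M.finsum_cong') (auto intro!: N.smult_l_distr)
    also have "\<dots> = (\<Oplus>\<^bsub>N\<^esub>i\<in>?A. v i \<odot>\<^bsub>N\<^esub> p i) \<oplus>\<^bsub>N\<^esub> (\<Oplus>\<^bsub>N\<^esub>i\<in>?A. w i \<odot>\<^bsub>N\<^esub> p i)"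
      using A(2) closed[OF v] closed[OF w] by (intro N.M.finsum_addf) auto
    also have "(\<Oplus>\<^bsub>N\<^esub>i\<in>?A. v i \<odot>\<^bsub>N\<^esub> p i) = free_eval R N p v" using sup[OF v A] by simp
    also have "(\<Oplus>\<^bsub>N\<^esub>i\<in>?A. w i \<odot>\<^bsub>N\<^esub> p i) = free_eval R N p w" using sup[OF w A] by simp
    finally show "free_eval R N p (v \<oplus>\<^bsub>free_mod R I\<^esub> w)
        = free_eval R N p v \<oplus>\<^bsub>N\<^esub> free_eval R N p w" .
  next
    fix r v assume r: "r \<in> carrier R" and v: "v \<in> carrier (free_mod R I)"
    let ?A = "{i. v i \<noteq> \<zero>\<^bsub>R\<^esub>}"
    have A: "finite ?A" "?A \<subseteq> I" using c(2,3)[OF v] by auto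
    have rv: "r \<odot>\<^bsub>free_mod R I\<^esub> v = (\<lambda>i. r \<otimes>\<^bsub>R\<^esub> v i)" by (simp add: free_mod_def)
    have sub: "{i. r \<otimes>\<^bsub>R\<^esub> v i \<noteq> \<zero>\<^bsub>R\<^esub>} \<subseteq> ?A" using r by auto
    have "free_eval R N p (r \<odot>\<^bsub>free_mod R I\<^esub> v) = (\<Oplus>\<^bsub>N\<^esub>i\<in>?A. (r \<otimes>\<^bsub>R\<^esub> v i) \<odot>\<^bsub>N\<^esub> p i)"
      unfolding rv by (rule sup[OF F.smult_closed[OF r v, unfolded rv] A sub])
    also have "\<dots> = (\<Oplus>\<^bsub>N\<^esub>i\<in>?A. r \<odot>\<^bsub>N\<^esub> (v i \<odot>\<^bsub>N\<^esub> p i))"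
      using A(2) closed[OF v] c(1)[OF v] assms(2) r
      by (intro N.M.finsum_cong') (auto intro!: N.smult_assoc1)
    also have "\<dots> = r \<odot>\<^bsub>N\<^esub> free_eval R N p v"
      using A(1,2) closed[OF v] r unfolding free_eval_def
    proof (induction rule: finite_induct)
      case (insert x F)
      then show ?case by (simp add: N.M.finsum_insert Pi_iff subset_iff N.smult_r_distr)
    qed simp
    finally show "free_eval R N p (r \<odot>\<^bsub>free_mod R I\<^esub> v) = r \<odot>\<^bsub>N\<^esub> free_eval R N p v" .
  qed
qed

lemma free_eval_unit:
  assumes "module R N" "i \<in> I" "p \<in> I \<rightarrow> carrier N"
  shows "free_eval R N p (free_unit R i) = p i"
proof -
  interpret N: module R N by fact
  have "free_eval R N p (free_unit R i) = (\<Oplus>\<^bsub>N\<^esub>j\<in>{i}. free_unit R i j \<odot>\<^bsub>N\<^esub> p j)"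
    by (rule free_eval_superset[OF assms(1) free_unit_mem[OF N.R.is_cring assms(2)] assms(3)])
      (use assms(2) in \<open>auto simp: free_unit_def\<close>)
  also have "\<dots> = free_unit R i i \<odot>\<^bsub>N\<^esub> p i"
    using assms(2,3) by (subst N.M.finsum_insert) (auto simp: free_unit_def intro!: N.M.r_zero)
  also have "\<dots> = p i" using N.smult_one[OF funcset_mem[OF assms(3,2)]] by (simp add: free_unit_def)
  finally show ?thesis .
qed

lemma mod_hom_zero:
  assumes "module R M" "module R N" "f \<in> mod_hom R M N"
  shows "f \<zero>\<^bsub>M\<^esub> = \<zero>\<^bsub>N\<^esub>"
proof -
  interpret M: module R M by fact
  interpret N: module R N by fact
  have "f (\<zero>\<^bsub>R\<^esub> \<odot>\<^bsub>M\<^esub> \<zero>\<^bsub>M\<^esub>) = \<zero>\<^bsub>R\<^esub> \<odot>\<^bsub>N\<^esub> f \<zero>\<^bsub>M\<^esub>" by (rule mod_homD(3)[OF assms(3)]) auto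
  then show ?thesis using mod_homD(1)[OF assms(3), of "\<zero>\<^bsub>M\<^esub>"] by simp
qed

lemma mod_hom_free_eval:
  assumes "module R N" "module R P" "g \<in> mod_hom R N P"
    and "v \<in> carrier (free_mod R I)" "p \<in> I \<rightarrow> carrier N"
  shows "g (free_eval R N p v) = free_eval R P (\<lambda>i. g (p i)) v"
proof -
  interpret N: module R N by fact
  interpret P: module R P by fact
  note c = free_mod_car[OF N.R.is_cring assms(4)]
  have "finite A \<Longrightarrow> A \<subseteq> I \<Longrightarrow>
    g (\<Oplus>\<^bsub>N\<^esub>i\<in>A. v i \<odot>\<^bsub>N\<^esub> p i) = (\<Oplus>\<^bsub>P\<^esub>i\<in>A. v i \<odot>\<^bsub>P\<^esub> g (p i))" for A
  proof (induction rule: finite_induct)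
    case empty then show ?case by (simp add: mod_hom_zero[OF assms(1-3)])
  next
    case (insert x F)
    have "p i \<in> carrier N \<and> g (p i) \<in> carrier P" if "i \<in> I" for i
      using that assms(5) mod_homD(1)[OF assms(3)] by auto
    with insert c(1) show ?case
      by (simp add: N.M.finsum_insert P.M.finsum_insert Pi_iff subset_iff
          mod_homD[OF assms(3)] N.M.finsum_closed)
  qed
  from this[of "{i. v i \<noteq> \<zero>\<^bsub>R\<^esub>}"] c(2,3) show ?thesis unfolding free_eval_def by blast
qed

theorem projective_module_lifts:
  fixes R :: "('a, 'r) ring_scheme" and M :: "('a, 'm) module"
    and N :: "('a, 'n) module" and P :: "('a, 'p) module"
  assumes M: "projective_module R M" and N: "module R N" and P: "module R P"
  shows "lifts_through R M N P"
proof -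
  have M': "module R M" using M by (simp add: projective_module_def)
  interpret M: module R M by fact
  interpret P: module R P by fact
  let ?F = "free_mod R (carrier M)"
  have F: "module R ?F" by (rule module_free_mod[OF M.R.is_cring])
  have e: "free_eval R M id \<in> mod_hom R ?F M" by (rule free_eval_hom[OF M']) auto
  have "free_eval R M id ` carrier ?F = carrier M"
  proof
    show "free_eval R M id ` carrier ?F \<subseteq> carrier M" using mod_homD(1)[OF e] by auto
    show "carrier M \<subseteq> free_eval R M id ` carrier ?F"
    proof
      fix x assume x: "x \<in> carrier M"
      have "free_eval R M id (free_unit R x) = id x" by (rule free_eval_unit[OF M' x]) auto
      then show "x \<in> free_eval R M id ` carrier ?F"
        using free_unit_mem[OF M.R.is_cring x] by (auto intro!: image_eqI[of _ _ "free_unit R x"])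
    qed
  qed
  moreover have "lifts_through R M ?F M"
    using M F M' unfolding projective_module_def by blast
  ultimately have "\<exists>s\<in>mod_hom R M ?F. \<forall>x\<in>carrier M. free_eval R M id (s x) = id x"
    using e mod_hom_id[of R M] unfolding lifts_through_def by blast
  then obtain s where s: "s \<in> mod_hom R M ?F"
    and es: "\<And>x. x \<in> carrier M \<Longrightarrow> free_eval R M id (s x) = x"
    by auto
  show ?thesis unfolding lifts_through_def
  proof (intro ballI impI)
    fix g f assume g: "g \<in> mod_hom R N P" and f: "f \<in> mod_hom R M P"
      and surj: "g ` carrier N = carrier P"
    have "\<forall>x\<in>carrier M. \<exists>n. n \<in> carrier N \<and> g n = f x"
    proof
      fix x assume "x \<in> carrier M"
      then have "f x \<in> g ` carrier N" using surj mod_homD(1)[OF f] by simp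
      then show "\<exists>n. n \<in> carrier N \<and> g n = f x" by auto
    qed
    from bchoice[OF this] obtain p
      where p: "\<And>x. x \<in> carrier M \<Longrightarrow> p x \<in> carrier N \<and> g (p x) = f x" by blast
    then have pc: "p \<in> carrier M \<rightarrow> carrier N" by (simp add: Pi_iff)
    have l: "free_eval R N p \<in> mod_hom R ?F N" by (rule free_eval_hom[OF N pc])
    have "(\<lambda>x. free_eval R N p (s x)) \<in> mod_hom R M N"
      unfolding mod_hom_def[of R M N] by (auto simp: mod_homD[OF l] mod_homD[OF s])
    moreover have "g (free_eval R N p (s x)) = f x" if x: "x \<in> carrier M" for x
    proof -
      note sx = mod_homD(1)[OF s x]
      note sup = free_mod_car[OF M.R.is_cring sx]
      have "g (free_eval R N p (s x)) = free_eval R P (\<lambda>i. g (p i)) (s x)"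
        by (rule mod_hom_free_eval[OF N P g sx pc])
      also have "\<dots> = free_eval R P (\<lambda>i. f (id i)) (s x)"
        unfolding free_eval_def
        by (intro P.M.finsum_cong') (use sup p mod_homD(1)[OF f] in auto)
      also have "\<dots> = f (free_eval R M id (s x))"
        by (rule mod_hom_free_eval[OF M' P f sx, symmetric]) auto
      finally show ?thesis by (simp add: es[OF x])
    qed
    ultimately show "\<exists>l\<in>mod_hom R M N. \<forall>x\<in>carrier M. g (l x) = f x"
      by (intro bexI[of _ "\<lambda>x. free_eval R N p (s x)"] ballI) simp_all
  qed
qed

lemma tensor_kernel_lift:
  fixes R :: "('a, 'r) ring_scheme" and M :: "('a, 'm) module"
    and F :: "('a, 'f) module" and P :: "('a, 'p) module"
  assumes M: "module R M" and F: "module R F" and P: "module R P"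
    and w: "w \<in> tensor_kernel R M P"
  shows "\<exists>T. finite T \<and> T \<subseteq> carrier P \<and>
    (\<forall>\<sigma> \<pi>. \<pi> \<in> mod_hom R F P \<longrightarrow> (\<forall>p\<in>T. \<sigma> p \<in> carrier F \<and> \<pi> (\<sigma> p) = p) \<longrightarrow>
       (\<exists>\<kappa> \<delta>. \<kappa> \<in> tensor_kernel R M F \<and>
          Poly_Mapping.keys \<delta> \<subseteq> carrier M \<times> {k \<in> carrier F. \<pi> k = \<zero>\<^bsub>P\<^esub>} \<and>
          frag_extend (\<lambda>(m, p). frag_of (m, \<sigma> p)) w = \<kappa> + \<delta>))"
proof -
  interpret M: module R M by fact
  interpret F: module R F by fact
  interpret P: module R P by fact
  note K = subgroup_free_Abelian_groupD[OF subgroup_tensor_kernel[OF M F]]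
  note rel = tensor_kernel_rel[OF M F]
  define L where "L \<pi> = {\<kappa> + \<delta> | \<kappa> \<delta>. \<kappa> \<in> tensor_kernel R M F \<and>
          Poly_Mapping.keys \<delta> \<subseteq> carrier M \<times> {k \<in> carrier F. \<pi> k = \<zero>\<^bsub>P\<^esub>}}" for \<pi> :: "'f \<Rightarrow> 'p"
  define ext where "ext \<sigma> = frag_extend (\<lambda>(m :: 'm, p). frag_of (m, \<sigma> p))" for \<sigma> :: "'p \<Rightarrow> 'f"
  have LK: "x \<in> L \<pi>" if "x \<in> tensor_kernel R M F" for x \<pi>
    unfolding L_def using that by (intro CollectI exI[of _ x] exI[of _ 0]) simp
  have Ladd: "x + y \<in> L \<pi>" if xy: "x \<in> L \<pi>" "y \<in> L \<pi>" for x y \<pi>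
  proof -
    obtain a b c d where "x = a + b" "y = c + d" "a \<in> tensor_kernel R M F" "c \<in> tensor_kernel R M F"
      "Poly_Mapping.keys b \<subseteq> carrier M \<times> {k \<in> carrier F. \<pi> k = \<zero>\<^bsub>P\<^esub>}"
      "Poly_Mapping.keys d \<subseteq> carrier M \<times> {k \<in> carrier F. \<pi> k = \<zero>\<^bsub>P\<^esub>}"
      using xy unfolding L_def by blast
    then show ?thesis unfolding L_def using K(3)[of a c] keys_add[of b d]
      by (intro CollectI exI[of _ "a + c"] exI[of _ "b + d"]) (auto simp: algebra_simps)
  qed
  have Lneg: "- x \<in> L \<pi>" if xy: "x \<in> L \<pi>" for x \<pi>
  proof -
    obtain a b where "x = a + b" "a \<in> tensor_kernel R M F"
      "Poly_Mapping.keys b \<subseteq> carrier M \<times> {k \<in> carrier F. \<pi> k = \<zero>\<^bsub>P\<^esub>}"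
      using xy unfolding L_def by blast
    then show ?thesis unfolding L_def using K(4)[of a]
      by (intro CollectI exI[of _ "- a"] exI[of _ "- b"]) auto
  qed
  have Ldiff: "frag_of (m, a) - frag_of (m, b) \<in> L \<pi>"
    if \<pi>: "\<pi> \<in> mod_hom R F P" and m: "m \<in> carrier M" and a: "a \<in> carrier F"
      and b: "b \<in> carrier F" and ab: "\<pi> a = \<pi> b" for m a b \<pi>
  proof -
    let ?k = "a \<ominus>\<^bsub>F\<^esub> b"
    have k: "?k \<in> carrier F" using a b by simp
    have bk: "b \<oplus>\<^bsub>F\<^esub> ?k = a" using a b by (simp add: a_minus_def F.M.a_lcomm F.M.r_neg)
    have "\<pi> b \<oplus>\<^bsub>P\<^esub> \<pi> ?k = \<pi> b" using mod_homD(2)[OF \<pi> b k] bk ab by simp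
    then have "\<pi> ?k = \<zero>\<^bsub>P\<^esub>" using mod_homD(1)[OF \<pi>] b k by (simp add: P.M.add.r_cancel_one)
    then have "Poly_Mapping.keys (frag_of (m, ?k)) \<subseteq> carrier M \<times> {k \<in> carrier F. \<pi> k = \<zero>\<^bsub>P\<^esub>}"
      using m k by (simp add: keys_frag_of)
    moreover have "frag_of (m, a) - frag_of (m, b)
       = (frag_of (m, b \<oplus>\<^bsub>F\<^esub> ?k) - frag_of (m, b) - frag_of (m, ?k)) + frag_of (m, ?k)"
      by (simp add: bk)
    ultimately show ?thesis
      unfolding L_def using rel(2)[OF m b k] by blast
  qed
  define good where "good w T \<longleftrightarrow> finite T \<and> T \<subseteq> carrier P \<and>
    (\<forall>\<sigma> \<pi>. \<pi> \<in> mod_hom R F P \<longrightarrow> (\<forall>p\<in>T. \<sigma> p \<in> carrier F \<and> \<pi> (\<sigma> p) = p) \<longrightarrow> ext \<sigma> w \<in> L \<pi>)"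
    for w T
  have goodrel: "\<exists>T. good r T" if "r \<in> tensor_relations R M P" for r
    using that unfolding tensor_relations_def
  proof (elim UnE CollectE exE conjE)
    fix x x' y
    assume r: "r = frag_of (x \<oplus>\<^bsub>M\<^esub> x', y) - frag_of (x, y) - frag_of (x', y)"
      and c: "x \<in> carrier M" "x' \<in> carrier M" "y \<in> carrier P"
    have "good r {y}" unfolding good_def r ext_def
      using c rel(1) by (auto simp: frag_extend_diff intro!: LK)
    then show ?thesis by blast
  next
    fix x y y'
    assume r: "r = frag_of (x, y \<oplus>\<^bsub>P\<^esub> y') - frag_of (x, y) - frag_of (x, y')"
      and c: "x \<in> carrier M" "y \<in> carrier P" "y' \<in> carrier P"
    have "good r {y, y', y \<oplus>\<^bsub>P\<^esub> y'}" unfolding good_def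
    proof (intro conjI allI impI)
      fix \<sigma> \<pi> assume \<pi>: "\<pi> \<in> mod_hom R F P"
        and "\<forall>p\<in>{y, y', y \<oplus>\<^bsub>P\<^esub> y'}. \<sigma> p \<in> carrier F \<and> \<pi> (\<sigma> p) = p"
      then have s: "\<sigma> y \<in> carrier F" "\<sigma> y' \<in> carrier F" "\<sigma> (y \<oplus>\<^bsub>P\<^esub> y') \<in> carrier F"
        "\<pi> (\<sigma> y) = y" "\<pi> (\<sigma> y') = y'" "\<pi> (\<sigma> (y \<oplus>\<^bsub>P\<^esub> y')) = y \<oplus>\<^bsub>P\<^esub> y'" by auto
      have "frag_of (x, \<sigma> (y \<oplus>\<^bsub>P\<^esub> y')) - frag_of (x, \<sigma> y \<oplus>\<^bsub>F\<^esub> \<sigma> y') \<in> L \<pi>"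
        using s c by (intro Ldiff[OF \<pi>]) (auto simp: mod_homD(2)[OF \<pi>])
      from Ladd[OF this LK[OF rel(2)[OF c(1) s(1,2)]]]
      show "ext \<sigma> r \<in> L \<pi>" by (simp add: ext_def r frag_extend_diff frag_extend_add algebra_simps)
    qed (use c in auto)
    then show ?thesis by blast
  next
    fix t x y
    assume r: "r = frag_of (t \<odot>\<^bsub>M\<^esub> x, y) - frag_of (x, t \<odot>\<^bsub>P\<^esub> y)"
      and c: "t \<in> carrier R" "x \<in> carrier M" "y \<in> carrier P"
    have "good r {y, t \<odot>\<^bsub>P\<^esub> y}" unfolding good_def
    proof (intro conjI allI impI)
      fix \<sigma> \<pi> assume \<pi>: "\<pi> \<in> mod_hom R F P"
        and "\<forall>p\<in>{y, t \<odot>\<^bsub>P\<^esub> y}. \<sigma> p \<in> carrier F \<and> \<pi> (\<sigma> p) = p"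
      then have s: "\<sigma> y \<in> carrier F" "\<sigma> (t \<odot>\<^bsub>P\<^esub> y) \<in> carrier F"
        "\<pi> (\<sigma> y) = y" "\<pi> (\<sigma> (t \<odot>\<^bsub>P\<^esub> y)) = t \<odot>\<^bsub>P\<^esub> y" by auto
      have "frag_of (x, t \<odot>\<^bsub>F\<^esub> \<sigma> y) - frag_of (x, \<sigma> (t \<odot>\<^bsub>P\<^esub> y)) \<in> L \<pi>"
        using s c by (intro Ldiff[OF \<pi>]) (auto simp: mod_homD(3)[OF \<pi>])
      from Ladd[OF this LK[OF rel(3)[OF c(1,2) s(1)]]]
      show "ext \<sigma> r \<in> L \<pi>" by (simp add: ext_def r frag_extend_diff frag_extend_add algebra_simps)
    qed (use c in auto)
    then show ?thesis by blast
  qed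
  have "\<exists>T. good w T"
    using w unfolding tensor_kernel_def
  proof (induction w rule: generate.induct)
    case one
    have "good 0 {}" unfolding good_def ext_def using LK[OF K(2)] by simp
    then show ?case by auto
  next
    case (incl h) then show ?case by (rule goodrel)
  next
    case (inv h)
    obtain T where "good h T" using goodrel[OF inv] by blast
    then have "good (- h) T" unfolding good_def ext_def by (auto simp: frag_extend_minus intro: Lneg)
    moreover have "inv\<^bsub>pair_group M P\<^esub> h = - h"
      using subsetD[OF keys_tensor_relations[OF M P] inv] by simp
    ultimately show ?case by auto
  next
    case (eng h1 h2)
    then obtain T1 T2 where "good h1 T1" "good h2 T2" by blast
    then have "good (h1 + h2) (T1 \<union> T2)"
      unfolding good_def ext_def by (auto simp: frag_extend_add intro!: Ladd)
    then show ?case by auto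
  qed
  then show ?thesis unfolding good_def L_def ext_def by (elim exE) (rule exI, blast)
qed

lemma frag_extend_frag_of_compose:
  "frag_extend (\<lambda>p. frag_of (f p)) (frag_extend (\<lambda>p. frag_of (g p)) x)
     = frag_extend (\<lambda>p. frag_of (f (g p))) x"
  using frag_extend_compose[of "\<lambda>p. frag_of (f p)" g] by (simp add: o_def fun_eq_iff)

lemma keys_frag_extend_frag_of:
  assumes "Poly_Mapping.keys x \<subseteq> A" "\<And>p. p \<in> A \<Longrightarrow> g p \<in> B"
  shows "Poly_Mapping.keys (frag_extend (\<lambda>p. frag_of (g p)) x) \<subseteq> B"
  using keys_frag_extend[of "\<lambda>p. frag_of (g p)" x] assms by (fastforce simp: keys_frag_of)

theorem flat_module_preserves_inj:
  fixes R :: "('a, 'r) ring_scheme" and M :: "('a, 'm) module"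
    and N :: "('a, 'n) module" and P :: "('a, 'p) module"
  assumes flat: "flat_module R M" and N: "module R N" and P: "module R P"
  shows "tensor_preserves_inj R M N P"
proof -
  have M: "module R M" using flat by (simp add: flat_module_def)
  interpret M: module R M by fact
  interpret N: module R N by fact
  interpret P: module R P by fact
  let ?F = "free_mod R (UNIV :: nat set)"
  have F: "module R ?F" by (rule module_free_mod[OF M.R.is_cring])
  interpret F: module R ?F by (rule F)
  note KN = subgroup_free_Abelian_groupD[OF subgroup_tensor_kernel[OF M N]]
  have core: "z \<in> tensor_kernel R M N"
    if f: "f \<in> mod_hom R N P" and inj: "inj_on f (carrier N)"
      and z: "Poly_Mapping.keys z \<subseteq> carrier M \<times> carrier N"
      and fz: "frag_extend (\<lambda>(m, n). frag_of (m, f n)) z \<in> tensor_kernel R M P" for f z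
  proof -
    let ?fz = "frag_extend (\<lambda>(m, n). frag_of (m, f n)) z"
    obtain T where T: "finite T" "T \<subseteq> carrier P"
      and lift: "\<forall>\<sigma> \<pi>. \<pi> \<in> mod_hom R ?F P \<longrightarrow> (\<forall>p\<in>T. \<sigma> p \<in> carrier ?F \<and> \<pi> (\<sigma> p) = p) \<longrightarrow>
       (\<exists>\<kappa> \<delta>. \<kappa> \<in> tensor_kernel R M ?F \<and>
          Poly_Mapping.keys \<delta> \<subseteq> carrier M \<times> {k \<in> carrier ?F. \<pi> k = \<zero>\<^bsub>P\<^esub>} \<and>
          frag_extend (\<lambda>(m, p). frag_of (m, \<sigma> p)) ?fz = \<kappa> + \<delta>)"
      using tensor_kernel_lift[OF M F P fz] by (elim exE conjE) (rule that)
    define T' where "T' = T \<union> f ` snd ` Poly_Mapping.keys z"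
    have T': "finite T'" "T' \<subseteq> carrier P"
      using T z mod_homD(1)[OF f] by (auto simp: T'_def)
    obtain idx :: "'p \<Rightarrow> nat" where idx: "inj_on idx T'"
      using finite_imp_inj_to_nat_seg[OF T'(1)] by blast
    define p where "p i = (if i \<in> idx ` T' then inv_into T' idx i else \<zero>\<^bsub>P\<^esub>)" for i
    have p: "p \<in> UNIV \<rightarrow> carrier P" using T'(2) by (auto simp: p_def inv_into_f_f[OF idx] subset_iff)
    define \<pi> where "\<pi> = free_eval R P p"
    define \<sigma> where "\<sigma> t = (free_unit R (idx t) :: nat \<Rightarrow> 'a)" for t
    have \<pi>: "\<pi> \<in> mod_hom R ?F P" unfolding \<pi>_def by (rule free_eval_hom[OF P p])
    have \<sigma>: "\<sigma> t \<in> carrier ?F" for t unfolding \<sigma>_def by (rule free_unit_mem[OF M.R.is_cring]) simp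
    have \<pi>\<sigma>: "\<pi> (\<sigma> t) = t" if "t \<in> T'" for t
      unfolding \<pi>_def \<sigma>_def using free_eval_unit[OF P _ p, of "idx t"] that
      by (simp add: p_def inv_into_f_f[OF idx])
    have "\<forall>p\<in>T. \<sigma> p \<in> carrier ?F \<and> \<pi> (\<sigma> p) = p" using \<sigma> \<pi>\<sigma> by (simp add: T'_def)
    from lift[THEN spec, THEN spec, THEN mp, THEN mp, OF \<pi> this]
    obtain \<kappa> \<delta> where \<kappa>: "\<kappa> \<in> tensor_kernel R M ?F"
      and \<delta>: "Poly_Mapping.keys \<delta> \<subseteq> carrier M \<times> {k \<in> carrier ?F. \<pi> k = \<zero>\<^bsub>P\<^esub>}"
      and eq: "frag_extend (\<lambda>(m, p). frag_of (m, \<sigma> p)) ?fz = \<kappa> + \<delta>"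
      by (elim exE conjE) (rule that)
    define w where "w = frag_extend (\<lambda>(m, n). frag_of (m, \<sigma> (f n))) z"
    have w: "w = \<kappa> + \<delta>"
      using eq frag_extend_frag_of_compose[of "\<lambda>(m, p). (m, \<sigma> p)" "\<lambda>(m, n). (m, f n)" z]
      by (simp add: w_def case_prod_unfold)
    define H where "H = {v \<in> carrier ?F. \<pi> v \<in> f ` carrier N}"
    have zeroH: "k \<in> H" if "k \<in> carrier ?F" "\<pi> k = \<zero>\<^bsub>P\<^esub>" for k
      using that mod_hom_zero[OF N P f] by (auto simp: H_def intro!: image_eqI[of _ _ "\<zero>\<^bsub>N\<^esub>"])
    have add_im: "a \<oplus>\<^bsub>P\<^esub> b \<in> f ` carrier N" if "a \<in> f ` carrier N" "b \<in> f ` carrier N" for a b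
      using that by (auto simp: mod_homD(2)[OF f, symmetric] intro!: imageI)
    have smult_im: "r \<odot>\<^bsub>P\<^esub> a \<in> f ` carrier N" if "a \<in> f ` carrier N" "r \<in> carrier R" for a r
      using that by (auto simp: mod_homD(3)[OF f, symmetric] intro!: imageI)
    have H_smult: "r \<odot>\<^bsub>?F\<^esub> v \<in> H" if "v \<in> H" "r \<in> carrier R" for v r
      using that smult_im by (auto simp: H_def mod_homD(3)[OF \<pi>])
    have "submodule H R ?F"
    proof (rule F.submoduleI)
      show "H \<subseteq> carrier ?F" by (auto simp: H_def)
      show "\<zero>\<^bsub>?F\<^esub> \<in> H" by (rule zeroH) (auto simp: mod_hom_zero[OF F P \<pi>])
      show "\<ominus>\<^bsub>?F\<^esub> v \<in> H" if "v \<in> H" for v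
      proof -
        have "\<ominus>\<^bsub>?F\<^esub> v = (\<ominus>\<^bsub>R\<^esub> \<one>\<^bsub>R\<^esub>) \<odot>\<^bsub>?F\<^esub> v"
          using that by (simp add: H_def F.smult_l_minus)
        then show ?thesis using H_smult[OF that] by simp
      qed
      show "a \<oplus>\<^bsub>?F\<^esub> b \<in> H" if "a \<in> H" "b \<in> H" for a b
        using that add_im by (auto simp: H_def mod_homD(2)[OF \<pi>])
    qed (rule H_smult)
    then have H: "module R (?F\<lparr>carrier := H\<rparr>)" (is "module R ?H")
      by (rule submodule.submodule_is_module[OF _ F])
    have \<kappa>H: "Poly_Mapping.keys \<kappa> \<subseteq> carrier M \<times> H"
    proof -
      have "\<sigma> (f n) \<in> H" if "(m, n) \<in> Poly_Mapping.keys z" for m n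
      proof -
        have "f n \<in> T'" using that by (force simp: T'_def)
        then show ?thesis using that z \<sigma> \<pi>\<sigma> by (auto simp: H_def)
      qed
      then have "Poly_Mapping.keys w \<subseteq> carrier M \<times> H"
        unfolding w_def case_prod_unfold
        by (intro keys_frag_extend_frag_of[of _ "Poly_Mapping.keys z"]) (use z in force)+
      moreover have "Poly_Mapping.keys \<delta> \<subseteq> carrier M \<times> H" using \<delta> zeroH by blast
      moreover have "\<kappa> = w - \<delta>" by (simp add: w)
      ultimately show ?thesis using keys_diff[of w \<delta>] by blast
    qed
    have "\<kappa> \<in> tensor_kernel R M ?H"
    proof -
      have id: "id \<in> mod_hom R ?H ?F" by (auto simp: mod_hom_def H_def)
      have "tensor_preserves_inj R M ?H ?F" using flat H F unfolding flat_module_def by blast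
      then have injF: "inj_on (tensor_map R M ?F id id) (carrier (tensor_module R M ?H))"
        unfolding tensor_preserves_inj_def using id by (auto simp: inj_on_id)
      let ?c = "\<lambda>x. tensor_kernel R M ?H #>\<^bsub>pair_group M ?H\<^esub> x"
      have mp: "tensor_map R M ?F id id (?c x) = tensor_kernel R M ?F #>\<^bsub>pair_group M ?F\<^esub> x" for x
        using tensor_map_coset[OF M H M F mod_hom_id id, of x]
        by (simp add: case_prod_unfold flip: frag_expansion)
      have cc: "?c x \<in> carrier (tensor_module R M ?H)" if "Poly_Mapping.keys x \<subseteq> carrier M \<times> H" for x
        using that by (auto simp: tensor_module_def carrier_FactGroup)
      have "tensor_map R M ?F id id (?c \<kappa>) = tensor_map R M ?F id id (?c 0)"
        using \<kappa> by (simp only: mp coset_eq_free_Abelian_group[OF subgroup_tensor_kernel[OF M F]] diff_0_right)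
      then have "?c \<kappa> = ?c 0"
        by (rule inj_onD[OF injF _ cc[OF \<kappa>H] cc]) simp
      then show ?thesis by (simp only: coset_eq_free_Abelian_group[OF subgroup_tensor_kernel[OF M H]] diff_0_right)
    qed
    moreover define q where "q v = inv_into (carrier N) f (\<pi> v)" for v
    have fq: "q v \<in> carrier N \<and> f (q v) = \<pi> v" if "v \<in> H" for v
      using that by (auto simp: q_def H_def inv_into_into f_inv_into_f)
    have q_eq: "q v = n" if "n \<in> carrier N" "\<pi> v = f n" for v n
      using that by (simp add: q_def inv_into_f_f[OF inj])
    have q: "q \<in> mod_hom R ?H N"
      unfolding mod_hom_def
    proof (intro CollectI conjI ballI funcsetI)
      fix v assume v: "v \<in> carrier ?H"
      then show "q v \<in> carrier N" using fq by simp
      fix w assume w: "w \<in> carrier ?H"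
      show "q (v \<oplus>\<^bsub>?H\<^esub> w) = q v \<oplus>\<^bsub>N\<^esub> q w"
        using v w fq by (intro q_eq) (auto simp: mod_homD(2)[OF \<pi>] mod_homD(2)[OF f] H_def)
    next
      fix r v assume "r \<in> carrier R" "v \<in> carrier ?H"
      then show "q (r \<odot>\<^bsub>?H\<^esub> v) = r \<odot>\<^bsub>N\<^esub> q v"
        using fq by (intro q_eq) (auto simp: mod_homD(3)[OF \<pi>] mod_homD(3)[OF f] H_def)
    qed
    let ?q = "frag_extend (\<lambda>(m, v). frag_of (id m, q v))"
    have "?q \<kappa> \<in> tensor_kernel R M N"
      by (rule tensor_kernel_hom[OF M H M N mod_hom_id q calculation])
    moreover have "?q \<delta> \<in> tensor_kernel R M N"
    proof (rule frag_extend_mem[OF subgroup_tensor_kernel[OF M N] _ \<delta>])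
      fix p assume "p \<in> carrier M \<times> {k \<in> carrier ?F. \<pi> k = \<zero>\<^bsub>P\<^esub>}"
      then obtain m k where mk: "p = (m, k)" "m \<in> carrier M" "\<pi> k = \<zero>\<^bsub>P\<^esub>" by blast
      have "q k = \<zero>\<^bsub>N\<^esub>" using mk mod_hom_zero[OF N P f] by (intro q_eq) auto
      moreover have "frag_of (m, \<zero>\<^bsub>N\<^esub>) \<in> tensor_kernel R M N"
        using KN(4)[OF tensor_kernel_rel(2)[OF M N mk(2), of "\<zero>\<^bsub>N\<^esub>" "\<zero>\<^bsub>N\<^esub>"]] by simp
      ultimately show "(case p of (m, v) \<Rightarrow> frag_of (id m, q v)) \<in> tensor_kernel R M N"
        by (simp add: mk)
    qed
    moreover have "?q w = z"
    proof -
      have "?q w = frag_extend (\<lambda>(m, n). frag_of (m, q (\<sigma> (f n)))) z"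
        using frag_extend_frag_of_compose[of "\<lambda>(m, v). (id m, q v)" "\<lambda>(m, n). (m, \<sigma> (f n))" z]
        by (simp add: w_def case_prod_unfold)
      also have "\<dots> = frag_extend frag_of z"
      proof (rule frag_extend_eq)
        fix x assume x: "x \<in> Poly_Mapping.keys z"
        then have "f (snd x) \<in> T'" by (auto simp: T'_def)
        then have "q (\<sigma> (f (snd x))) = snd x" using x z \<pi>\<sigma> by (intro q_eq) auto
        then show "(case x of (m, n) \<Rightarrow> frag_of (m, q (\<sigma> (f n)))) = frag_of x"
          by (simp add: case_prod_unfold)
      qed
      finally show ?thesis by (simp flip: frag_expansion)
    qed
    ultimately show ?thesis using KN(3) w by (metis frag_extend_add)
  qed
  show ?thesis unfolding tensor_preserves_inj_def
  proof (intro ballI impI inj_onI)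
    fix f X Y assume f: "f \<in> mod_hom R N P" and inj: "inj_on f (carrier N)"
      and "X \<in> carrier (tensor_module R M N)" "Y \<in> carrier (tensor_module R M N)"
      and eq: "tensor_map R M P id f X = tensor_map R M P id f Y"
    then obtain x y where x: "Poly_Mapping.keys x \<subseteq> carrier M \<times> carrier N"
        "X = tensor_kernel R M N #>\<^bsub>pair_group M N\<^esub> x"
      and y: "Poly_Mapping.keys y \<subseteq> carrier M \<times> carrier N"
        "Y = tensor_kernel R M N #>\<^bsub>pair_group M N\<^esub> y"
      by (auto simp: tensor_module_def carrier_FactGroup)
    have "frag_extend (\<lambda>(m, n). frag_of (m, f n)) (x - y) \<in> tensor_kernel R M P"
      using eq by (simp add: x y tensor_map_coset[OF M N M P mod_hom_id f] frag_extend_diff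
          coset_eq_free_Abelian_group[OF subgroup_tensor_kernel[OF M P]])
    then have "x - y \<in> tensor_kernel R M N"
      using x y keys_diff[of x y] by (intro core[OF f inj]) auto
    then show "X = Y"
      by (simp add: x y coset_eq_free_Abelian_group[OF subgroup_tensor_kernel[OF M N]])
  qed
qed

end

theory Submission
  imports Defs
begin

text \<open>
  Write \<open>M = F / K\<close> with \<open>F = R\<^sup>n\<close>. By the equational criterion, flatness of \<open>M\<close> gives for every
  finite subset of \<open>K\<close> an endomorphism \<open>T\<close> of \<open>F\<close> over \<open>M\<close> that kills this subset. If \<open>M \<otimes>\<^sub>R S\<close> is
  projective, then the kernel of \<open>S\<^sup>n \<rightarrow> M \<otimes>\<^sub>R S\<close> is a direct summand of \<open>S\<^sup>n\<close>, so it is finitely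
  generated, and as it is spanned by the image of \<open>K\<close>, it is generated by the images of finitely
  many elements of \<open>K\<close>. An endomorphism \<open>T\<close> that kills these kills, after extension to \<open>S\<close>, the
  images of all elements of \<open>K\<close>. Since \<open>R \<rightarrow> S\<close> is injective, \<open>T\<close> itself kills \<open>K\<close>, and so it
  induces a section of \<open>F \<rightarrow> M\<close>.
\<close>

section \<open>Homomorphisms and free modules\<close>

text \<open>The obstacle is that \<open>K\<close> is not known to be finitely generated, while
  flatness only provides an endomorphism for finitely many relations at a time; this is why a
  finitely generated flat module can fail to be projective. Over \<open>S\<close> finitely many
  relations suffice, and the endomorphism is chosen after these are known. That the kernel over
  \<open>S\<close> is spanned by the image of \<open>K\<close> is right exactness of the tensor
  product. As the tensor product is a quotient by generated relations, kernels are hard to reach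
  from inside it. Both right exactness and the equational criterion are therefore obtained by a map
  out of the tensor product, built from chosen preimages and well defined only modulo a suitable
  subgroup; \<open>tensor_kernel_universal\<close> serves both. The forward direction is the
  adjunction between extension and restriction of scalars: a lifting problem for M \<otimes> S over
  \<open>S\<close> becomes one for \<open>M\<close> over \<open>R\<close>.\<close>

lemma (in abelian_group) add_diff_cancel:
  assumes "x \<in> carrier G" "y \<in> carrier G"
  shows "y \<oplus> (x \<ominus> y) = x"
  using a_lcomm[of y x "\<ominus> y"] assms by (simp add: a_minus_def r_neg)

lemma mod_hom_compose:
  assumes "f \<in> mod_hom R M N" "g \<in> mod_hom R N P"
  shows "(\<lambda>x. g (f x)) \<in> mod_hom R M P"
  unfolding mod_hom_def by (auto simp: mod_homD[OF assms(1)] mod_homD[OF assms(2)])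

lemma mod_hom_add:
  assumes "module R N" and f: "f \<in> mod_hom R M N" and g: "g \<in> mod_hom R M N"
  shows "(\<lambda>x. f x \<oplus>\<^bsub>N\<^esub> g x) \<in> mod_hom R M N"
proof -
  interpret N: module R N by fact
  show ?thesis unfolding mod_hom_def
    by (auto simp: mod_homD[OF f] mod_homD[OF g] N.M.a_ac N.smult_r_distr)
qed

lemma mod_hom_const_zero:
  assumes "module R N"
  shows "(\<lambda>x. \<zero>\<^bsub>N\<^esub>) \<in> mod_hom R M N"
proof -
  interpret N: module R N by fact
  show ?thesis by (auto simp: mod_hom_def)
qed

lemma mod_hom_minus:
  assumes M: "module R M" and N: "module R N" and f: "f \<in> mod_hom R M N"
    and x: "x \<in> carrier M" and y: "y \<in> carrier M"
  shows "f (\<ominus>\<^bsub>M\<^esub> x) = \<ominus>\<^bsub>N\<^esub> f x" and "f (x \<ominus>\<^bsub>M\<^esub> y) = f x \<ominus>\<^bsub>N\<^esub> f y"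
proof -
  interpret M: module R M by fact
  interpret N: module R N by fact
  have *: "f (\<ominus>\<^bsub>M\<^esub> z) = \<ominus>\<^bsub>N\<^esub> f z" if "z \<in> carrier M" for z
  proof -
    have "f (\<ominus>\<^bsub>M\<^esub> z) = f ((\<ominus>\<^bsub>R\<^esub> \<one>\<^bsub>R\<^esub>) \<odot>\<^bsub>M\<^esub> z)" using that by (simp add: M.smult_l_minus)
    also have "\<dots> = \<ominus>\<^bsub>N\<^esub> f z"
      using that by (simp add: mod_homD(3)[OF f] N.smult_l_minus mod_homD(1)[OF f])
    finally show ?thesis .
  qed
  show "f (\<ominus>\<^bsub>M\<^esub> x) = \<ominus>\<^bsub>N\<^esub> f x" using * x .
  show "f (x \<ominus>\<^bsub>M\<^esub> y) = f x \<ominus>\<^bsub>N\<^esub> f y" using x y by (simp add: a_minus_def mod_homD(2)[OF f] *)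
qed

lemma mod_hom_minus_eq_zero:
  assumes "module R M" "module R N" "f \<in> mod_hom R M N" "x \<in> carrier M" "y \<in> carrier M" "f x = f y"
  shows "f (x \<ominus>\<^bsub>M\<^esub> y) = \<zero>\<^bsub>N\<^esub>"
proof -
  interpret N: module R N by fact
  show ?thesis using assms mod_homD(1)[OF assms(3,5)]
    by (simp add: mod_hom_minus(2)[OF assms(1-5)]) (simp add: a_minus_def N.M.r_neg)
qed

text \<open>\<open>restricted_ring R id\<close> is \<open>R\<close> regarded as a module over
  itself; the map is the one that sends 1 to \<open>m\<close>.\<close>

lemma mod_hom_smult_const:
  assumes "module R M" "m \<in> carrier M"
  shows "(\<lambda>r. r \<odot>\<^bsub>M\<^esub> m) \<in> mod_hom R (restricted_ring R id) M"
proof -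
  interpret M: module R M by fact
  show ?thesis using assms(2)
    by (auto simp: mod_hom_def restricted_ring_def M.smult_l_distr M.smult_assoc1)
qed

lemma module_image:
  assumes M: "module R M" and N: "module R N" and f: "f \<in> mod_hom R M N"
  shows "module R (N\<lparr>carrier := f ` carrier M\<rparr>)"
proof -
  interpret M: module R M by fact
  interpret N: module R N by fact
  have "submodule (f ` carrier M) R N"
  proof (rule N.submoduleI)
    show "f ` carrier M \<subseteq> carrier N" using mod_homD(1)[OF f] by blast
    show "\<zero>\<^bsub>N\<^esub> \<in> f ` carrier M"
      using mod_hom_zero[OF M N f] by (auto intro!: image_eqI[of _ _ "\<zero>\<^bsub>M\<^esub>"])
    show "\<ominus>\<^bsub>N\<^esub> a \<in> f ` carrier M" if "a \<in> f ` carrier M" for a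
      using that by (auto simp: mod_hom_minus(1)[OF M N f, symmetric])
    show "a \<oplus>\<^bsub>N\<^esub> b \<in> f ` carrier M" if "a \<in> f ` carrier M" "b \<in> f ` carrier M" for a b
      using that by (auto simp: mod_homD(2)[OF f, symmetric])
    show "r \<odot>\<^bsub>N\<^esub> a \<in> f ` carrier M" if "r \<in> carrier R" "a \<in> f ` carrier M" for r a
      using that by (auto simp: mod_homD(3)[OF f, symmetric])
  qed
  then show ?thesis by (rule submodule.submodule_is_module[OF _ N])
qed

section \<open>Free modules: standard basis, equality of homomorphisms, retracts\<close>

lemma free_mod_add_apply: "(v \<oplus>\<^bsub>free_mod R I\<^esub> w) i = v i \<oplus>\<^bsub>R\<^esub> w i"
  and free_mod_smult_apply: "(r \<odot>\<^bsub>free_mod R I\<^esub> v) i = r \<otimes>\<^bsub>R\<^esub> v i"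
  by (simp_all add: free_mod_def)

lemma free_eval_cong:
  assumes "module R N" "v \<in> carrier (free_mod R I)" "q \<in> I \<rightarrow> carrier N"
    and "\<And>i. i \<in> I \<Longrightarrow> p i = q i"
  shows "free_eval R N p v = free_eval R N q v"
proof -
  interpret N: module R N by fact
  note c = free_mod_car[OF N.R.is_cring assms(2)]
  show ?thesis unfolding free_eval_def
    by (rule N.M.finsum_cong') (use c assms(3,4) in \<open>auto simp: Pi_iff\<close>)
qed

text \<open>Evaluation at a coordinate \<open>j\<close> is a homomorphism to \<open>R\<close>, so it
  passes through the finite sum, of which only the term at \<open>j\<close> can survive.\<close>

lemma free_eval_free_unit:
  assumes "cring R" and v: "v \<in> carrier (free_mod R I)"
  shows "free_eval R (free_mod R I) (free_unit R) v = v"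
proof
  fix j
  interpret R: cring R by fact
  let ?F = "free_mod R I" and ?R = "restricted_ring R id"
  have F: "module R ?F" by (rule module_free_mod[OF assms(1)])
  have id: "id \<in> ring_hom R R" by (simp add: ring_hom_def)
  have R: "module R ?R" by (rule module_restricted_ring[OF assms(1) assms(1) id])
  interpret Rm: module R ?R by (rule R)
  note c = free_mod_car[OF assms(1)]
  have coord: "(\<lambda>w. w j) \<in> mod_hom R ?F ?R"
    using c(1) by (auto simp: mod_hom_def restricted_ring_def) (simp_all add: free_mod_def)
  have u: "free_unit R \<in> I \<rightarrow> carrier ?F" by (rule funcsetI) (rule free_unit_mem[OF assms(1)])
  have "free_eval R ?F (free_unit R) v j = free_eval R ?R (\<lambda>i. free_unit R i j) v"
    by (rule mod_hom_free_eval[OF F R coord v u])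
  also have "\<dots> = (\<Oplus>\<^bsub>?R\<^esub>i\<in>{i. v i \<noteq> \<zero>\<^bsub>R\<^esub>}. if j = i then v i else \<zero>\<^bsub>?R\<^esub>)"
    unfolding free_eval_def using c(1)[OF v]
    by (intro Rm.M.finsum_cong') (auto simp: restricted_ring_def free_unit_def)
  also have "\<dots> = v j"
  proof (cases "v j = \<zero>\<^bsub>R\<^esub>")
    case True
    then have "(\<Oplus>\<^bsub>?R\<^esub>i\<in>{i. v i \<noteq> \<zero>\<^bsub>R\<^esub>}. if j = i then v i else \<zero>\<^bsub>?R\<^esub>)
       = (\<Oplus>\<^bsub>?R\<^esub>i\<in>{i. v i \<noteq> \<zero>\<^bsub>R\<^esub>}. \<zero>\<^bsub>?R\<^esub>)"
      using c(1)[OF v] by (intro Rm.M.finsum_cong') auto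
    also have "\<dots> = \<zero>\<^bsub>?R\<^esub>" by simp
    finally show ?thesis using True by (simp add: restricted_ring_def)
  next
    case False
    then show ?thesis using c(1,2)[OF v]
      by (intro Rm.M.finsum_singleton) (auto simp: restricted_ring_def)
  qed
  finally show "free_eval R ?F (free_unit R) v j = v j" .
qed

lemma free_mod_hom_eqI:
  assumes N: "module R N" and f: "f \<in> mod_hom R (free_mod R I) N"
    and g: "g \<in> mod_hom R (free_mod R I) N"
    and eq: "\<And>i. i \<in> I \<Longrightarrow> f (free_unit R i) = g (free_unit R i)"
    and v: "v \<in> carrier (free_mod R I)"
  shows "f v = g v"
proof -
  interpret N: module R N by fact
  have R: "cring R" by (rule N.R.is_cring)
  note F = module_free_mod[OF R, of I]
  have u: "free_unit R \<in> I \<rightarrow> carrier (free_mod R I)" by (rule funcsetI) (rule free_unit_mem[OF R])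
  have "f v = free_eval R N (\<lambda>i. f (free_unit R i)) v"
    using mod_hom_free_eval[OF F N f v u] free_eval_free_unit[OF R v] by simp
  also have "\<dots> = free_eval R N (\<lambda>i. g (free_unit R i)) v"
    using u mod_homD(1)[OF g] by (intro free_eval_cong[OF N v] eq) auto
  also have "\<dots> = g v"
    using mod_hom_free_eval[OF F N g v u] free_eval_free_unit[OF R v] by simp
  finally show ?thesis .
qed

text \<open>\<open>s\<close> makes \<open>M\<close> a retract of a free module: the images of the
  basis are lifted through \<open>g\<close>, the lift is extended linearly and precomposed with
  \<open>s\<close>. The types of \<open>N\<close> and \<open>P\<close> are arbitrary here.\<close>

lemma lifts_through_of_section:
  assumes M: "module R M" and N: "module R N" and P: "module R P" and p: "p \<in> I \<rightarrow> carrier M"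
    and s: "s \<in> mod_hom R M (free_mod R I)"
    and ps: "\<And>x. x \<in> carrier M \<Longrightarrow> free_eval R M p (s x) = x"
  shows "lifts_through R M N P"
  unfolding lifts_through_def
proof (intro ballI impI)
  fix g f assume g: "g \<in> mod_hom R N P" and f: "f \<in> mod_hom R M P"
    and surj: "g ` carrier N = carrier P"
  have "\<forall>i\<in>I. \<exists>n. n \<in> carrier N \<and> g n = f (p i)"
  proof
    fix i assume "i \<in> I"
    then have "f (p i) \<in> g ` carrier N" using surj mod_homD(1)[OF f] p by auto
    then show "\<exists>n. n \<in> carrier N \<and> g n = f (p i)" by auto
  qed
  then obtain q where q: "\<And>i. i \<in> I \<Longrightarrow> q i \<in> carrier N \<and> g (q i) = f (p i)"
    by (metis bchoice)
  then have qc: "q \<in> I \<rightarrow> carrier N" by blast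
  show "\<exists>l\<in>mod_hom R M N. \<forall>x\<in>carrier M. g (l x) = f x"
  proof (intro bexI ballI)
    show "(\<lambda>x. free_eval R N q (s x)) \<in> mod_hom R M N"
      by (rule mod_hom_compose[OF s free_eval_hom[OF N qc]])
    fix x assume x: "x \<in> carrier M"
    note sx = mod_homD(1)[OF s x]
    have "g (free_eval R N q (s x)) = free_eval R P (\<lambda>i. g (q i)) (s x)"
      by (rule mod_hom_free_eval[OF N P g sx qc])
    also have "\<dots> = free_eval R P (\<lambda>i. f (p i)) (s x)"
      using q p mod_homD(1)[OF f] by (intro free_eval_cong[OF P sx]) auto
    also have "\<dots> = f (free_eval R M p (s x))"
      by (rule mod_hom_free_eval[OF M P f sx p, symmetric])
    finally show "g (free_eval R N q (s x)) = f x" by (simp add: ps[OF x])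
  qed
qed

section \<open>Extension of scalars\<close>

text \<open>
  The map \<open>b\<close> need only be balanced modulo \<open>W\<close>, so that it may be built from arbitrary choices of
  preimages.
\<close>

lemma tensor_kernel_universal:
  assumes M: "module R M" and N: "module R N" and A: "comm_group A" and W: "subgroup W A"
    and b: "\<And>x y. x \<in> carrier M \<Longrightarrow> y \<in> carrier N \<Longrightarrow> b x y \<in> carrier A"
    and addl: "\<And>x x' y. x \<in> carrier M \<Longrightarrow> x' \<in> carrier M \<Longrightarrow> y \<in> carrier N \<Longrightarrow>
      \<exists>w\<in>W. b (x \<oplus>\<^bsub>M\<^esub> x') y = b x y \<otimes>\<^bsub>A\<^esub> b x' y \<otimes>\<^bsub>A\<^esub> w"
    and addr: "\<And>x y y'. x \<in> carrier M \<Longrightarrow> y \<in> carrier N \<Longrightarrow> y' \<in> carrier N \<Longrightarrow>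
      \<exists>w\<in>W. b x (y \<oplus>\<^bsub>N\<^esub> y') = b x y \<otimes>\<^bsub>A\<^esub> b x y' \<otimes>\<^bsub>A\<^esub> w"
    and bal: "\<And>r x y. r \<in> carrier R \<Longrightarrow> x \<in> carrier M \<Longrightarrow> y \<in> carrier N \<Longrightarrow>
      \<exists>w\<in>W. b (r \<odot>\<^bsub>M\<^esub> x) y = b x (r \<odot>\<^bsub>N\<^esub> y) \<otimes>\<^bsub>A\<^esub> w"
  obtains \<psi> where "\<psi> \<in> hom (pair_group M N) A"
    and "\<And>x y. x \<in> carrier M \<Longrightarrow> y \<in> carrier N \<Longrightarrow> \<psi> (frag_of (x, y)) = b x y"
    and "\<And>z. z \<in> tensor_kernel R M N \<Longrightarrow> \<psi> z \<in> W"
proof -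
  interpret M: module R M by fact
  interpret N: module R N by fact
  interpret A: comm_group A by fact
  interpret W: subgroup W A by fact
  have "(\<lambda>(x, y). b x y) ` (carrier M \<times> carrier N) \<subseteq> carrier A" using b by auto
  from A.free_Abelian_group_universal[OF this] obtain \<psi>
    where \<psi>: "\<psi> \<in> hom (pair_group M N) A"
      and "\<And>p. p \<in> carrier M \<times> carrier N \<Longrightarrow> \<psi> (frag_of p) = (case p of (x, y) \<Rightarrow> b x y)" by metis
  then have of: "\<psi> (frag_of (x, y)) = b x y" if "x \<in> carrier M" "y \<in> carrier N" for x y
    using that by auto
  interpret \<psi>: group_hom "pair_group M N" A \<psi>
    using \<psi> by (simp add: group_hom_def group_hom_axioms_def A.is_group)
  \<comment> \<open>The preimage of \<open>W\<close> is a subgroup and \<open>tensor_kernel\<close>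
    is generated by the relations, so it is enough to send each relation into
    \<open>W\<close>.\<close>
  let ?V = "{z \<in> carrier (pair_group M N). \<psi> z \<in> W}"
  have V: "subgroup ?V (pair_group M N)"
  proof (rule subgroup.intro)
    show "x \<otimes>\<^bsub>pair_group M N\<^esub> y \<in> ?V" if "x \<in> ?V" "y \<in> ?V" for x y
      using that \<psi>.hom_mult[of x y] \<psi>.G.m_closed[of x y] W.m_closed by simp
    show "inv\<^bsub>pair_group M N\<^esub> x \<in> ?V" if "x \<in> ?V" for x
      using that \<psi>.hom_inv[of x] \<psi>.G.inv_closed[of x] W.m_inv_closed
      by (simp del: inv_free_Abelian_group)
  qed (use \<psi>.hom_one in auto)
  have "tensor_relations R M N \<subseteq> ?V"
  proof
    fix r assume r: "r \<in> tensor_relations R M N"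
    have diff: "\<psi> (u - v) = \<psi> u \<otimes>\<^bsub>A\<^esub> inv\<^bsub>A\<^esub> \<psi> v"
      if "Poly_Mapping.keys u \<subseteq> carrier M \<times> carrier N" "Poly_Mapping.keys v \<subseteq> carrier M \<times> carrier N" for u v
      using \<psi>.hom_mult[of u "- v"] \<psi>.hom_inv[of v] that by simp
    have kd: "Poly_Mapping.keys (u - v) \<subseteq> carrier M \<times> carrier N"
      if "Poly_Mapping.keys u \<subseteq> carrier M \<times> carrier N" "Poly_Mapping.keys v \<subseteq> carrier M \<times> carrier N"
      for u v
      using that keys_diff[of u v] by blast
    have cancel: "a \<otimes>\<^bsub>A\<^esub> c \<otimes>\<^bsub>A\<^esub> w \<otimes>\<^bsub>A\<^esub> inv\<^bsub>A\<^esub> a \<otimes>\<^bsub>A\<^esub> inv\<^bsub>A\<^esub> c = w"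
      if "a \<in> carrier A" "c \<in> carrier A" "w \<in> W" for a c w
    proof -
      have w: "w \<in> carrier A" using W.subset that(3) by blast
      have "a \<otimes>\<^bsub>A\<^esub> c \<otimes>\<^bsub>A\<^esub> w = w \<otimes>\<^bsub>A\<^esub> c \<otimes>\<^bsub>A\<^esub> a" using that(1,2) w by (simp add: A.m_ac)
      then show ?thesis using that(1,2) w by (simp add: A.inv_solve_right')
    qed
    have cancel': "a \<otimes>\<^bsub>A\<^esub> w \<otimes>\<^bsub>A\<^esub> inv\<^bsub>A\<^esub> a = w" if "a \<in> carrier A" "w \<in> W" for a w
      using that cancel[of a "\<one>\<^bsub>A\<^esub>" w] by simp
    have "\<psi> r \<in> W" using r unfolding tensor_relations_def
    proof (elim UnE CollectE exE conjE)
      fix x x' y assume r: "r = frag_of (x \<oplus>\<^bsub>M\<^esub> x', y) - frag_of (x, y) - frag_of (x', y)"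
        and c: "x \<in> carrier M" "x' \<in> carrier M" "y \<in> carrier N"
      then obtain w where "w \<in> W" "b (x \<oplus>\<^bsub>M\<^esub> x') y = b x y \<otimes>\<^bsub>A\<^esub> b x' y \<otimes>\<^bsub>A\<^esub> w"
        using addl by blast
      then show "\<psi> r \<in> W" using c b cancel by (simp add: r diff kd of)
    next
      fix x y y' assume r: "r = frag_of (x, y \<oplus>\<^bsub>N\<^esub> y') - frag_of (x, y) - frag_of (x, y')"
        and c: "x \<in> carrier M" "y \<in> carrier N" "y' \<in> carrier N"
      then obtain w where "w \<in> W" "b x (y \<oplus>\<^bsub>N\<^esub> y') = b x y \<otimes>\<^bsub>A\<^esub> b x y' \<otimes>\<^bsub>A\<^esub> w"
        using addr by blast
      then show "\<psi> r \<in> W" using c b cancel by (simp add: r diff kd of)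
    next
      fix t x y assume r: "r = frag_of (t \<odot>\<^bsub>M\<^esub> x, y) - frag_of (x, t \<odot>\<^bsub>N\<^esub> y)"
        and c: "t \<in> carrier R" "x \<in> carrier M" "y \<in> carrier N"
      then obtain w where "w \<in> W" "b (t \<odot>\<^bsub>M\<^esub> x) y = b x (t \<odot>\<^bsub>N\<^esub> y) \<otimes>\<^bsub>A\<^esub> w"
        using bal by blast
      then show "\<psi> r \<in> W" using c b cancel' by (simp add: r diff of)
    qed
    then show "r \<in> ?V" using subsetD[OF keys_tensor_relations[OF M N] r] by simp
  qed
  then have "tensor_kernel R M N \<subseteq> ?V"
    unfolding tensor_kernel_def by (rule \<psi>.G.generate_subgroup_incl[OF _ V])
  then show thesis using that[OF \<psi> of] by blast
qed

lemma hom_pair_group_sum: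
  assumes "comm_group A" and \<psi>: "\<psi> \<in> hom (pair_group M N) A" and "finite J"
    and "p \<in> J \<rightarrow> carrier M" "q \<in> J \<rightarrow> carrier N"
  shows "\<psi> (\<Sum>j\<in>J. frag_of (p j, q j)) = (\<Otimes>\<^bsub>A\<^esub>j\<in>J. \<psi> (frag_of (p j, q j)))"
proof -
  interpret A: comm_group A by fact
  interpret \<psi>: group_hom "pair_group M N" A \<psi>
    using \<psi> by (simp add: group_hom_def group_hom_axioms_def A.is_group)
  show ?thesis using assms(3-)
  proof (induction J)
    case empty
    then show ?case using \<psi>.hom_one by simp
  next
    case (insert j J)
    have "(\<Sum>j\<in>J. frag_of (p j, q j)) \<in> carrier (pair_group M N)"
      using insert.prems by (intro sum_closed_free_Abelian_group) (auto simp: Pi_iff)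
    then have "\<psi> (frag_of (p j, q j) + (\<Sum>j\<in>J. frag_of (p j, q j)))
      = \<psi> (frag_of (p j, q j)) \<otimes>\<^bsub>A\<^esub> \<psi> (\<Sum>j\<in>J. frag_of (p j, q j))"
      using \<psi>.hom_mult[of "frag_of (p j, q j)" "\<Sum>j\<in>J. frag_of (p j, q j)"] insert by simp
    moreover have "\<psi> (frag_of (p i, q i)) \<in> carrier A" if "i \<in> insert j J" for i
      using that insert.prems by (intro \<psi>.hom_closed) auto
    ultimately show ?case using insert by (simp add: Pi_iff)
  qed
qed

section \<open>Restriction of scalars and calculation in the base change\<close>

definition restrict_scalars :: "('a \<Rightarrow> 's) \<Rightarrow> ('s, 'n) module \<Rightarrow> ('a, 'n) module"
  where "restrict_scalars h N =
    \<lparr>carrier = carrier N, monoid.mult = (\<otimes>\<^bsub>N\<^esub>), one = \<one>\<^bsub>N\<^esub>, ring.zero = \<zero>\<^bsub>N\<^esub>, add = (\<oplus>\<^bsub>N\<^esub>),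
     smult = (\<lambda>r n. h r \<odot>\<^bsub>N\<^esub> n)\<rparr>"

lemma restrict_scalars_simps [simp]:
  "carrier (restrict_scalars h N) = carrier N"
  "\<zero>\<^bsub>restrict_scalars h N\<^esub> = \<zero>\<^bsub>N\<^esub>"
  "x \<oplus>\<^bsub>restrict_scalars h N\<^esub> y = x \<oplus>\<^bsub>N\<^esub> y"
  "r \<odot>\<^bsub>restrict_scalars h N\<^esub> x = h r \<odot>\<^bsub>N\<^esub> x"
  by (simp_all add: restrict_scalars_def)

lemma restricted_ring_simps [simp]:
  "carrier (restricted_ring S h) = carrier S"
  "\<zero>\<^bsub>restricted_ring S h\<^esub> = \<zero>\<^bsub>S\<^esub>"
  "x \<oplus>\<^bsub>restricted_ring S h\<^esub> y = x \<oplus>\<^bsub>S\<^esub> y"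
  "r \<odot>\<^bsub>restricted_ring S h\<^esub> x = h r \<otimes>\<^bsub>S\<^esub> x"
  by (simp_all add: restricted_ring_def)

lemma module_restrict_scalars:
  assumes "cring R" "h \<in> ring_hom R S" "module S N"
  shows "module R (restrict_scalars h N)"
proof -
  interpret R: cring R by fact
  interpret N: module S N by fact
  have "abelian_group (restrict_scalars h N)"
    by (rule abelian_groupI) (auto simp: N.M.a_assoc intro: N.M.a_comm N.M.add.l_inv_ex)
  then show ?thesis
    using assms(2)
    by (intro moduleI assms(1))
      (auto simp: ring_hom_closed ring_hom_add ring_hom_mult ring_hom_one
        N.smult_l_distr N.smult_r_distr N.smult_assoc1)
qed

lemma mod_hom_restrict_scalars:
  assumes "h \<in> ring_hom R S" "f \<in> mod_hom S N P"
  shows "f \<in> mod_hom R (restrict_scalars h N) (restrict_scalars h P)"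
  using assms(2) ring_hom_closed[OF assms(1)] by (auto simp: mod_hom_def)

definition pure_tensor ::
  "('a, 'r) ring_scheme \<Rightarrow> ('a, 'm) module \<Rightarrow> ('s, 't) ring_scheme \<Rightarrow> ('a \<Rightarrow> 's) \<Rightarrow>
     'm \<Rightarrow> 's \<Rightarrow> ('m \<times> 's \<Rightarrow>\<^sub>0 int) set"
  where "pure_tensor R M S h m t =
    tensor_kernel R M (restricted_ring S h) #>\<^bsub>pair_group M (restricted_ring S h)\<^esub> frag_of (m, t)"

locale scalar_extension = M: module R M + S: cring S
  for R :: "('a, 'r) ring_scheme" and M :: "('a, 'm) module" and S :: "('s, 't) ring_scheme" +
  fixes h :: "'a \<Rightarrow> 's"
  assumes h: "h \<in> ring_hom R S"
begin

abbreviation "B \<equiv> base_change R M S h"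
abbreviation "S\<^sub>R \<equiv> restricted_ring S h"
abbreviation "pure \<equiv> pure_tensor R M S h"
text \<open>Written with \<open>carrier S\<close> in place of the carrier of the restricted ring,
  the form to which \<open>restricted_ring_simps\<close> rewrites it.\<close>

abbreviation "coset x \<equiv>
  tensor_kernel R M S\<^sub>R #>\<^bsub>free_Abelian_group (carrier M \<times> carrier S)\<^esub> x"

lemma module_M: "module R M" ..

lemma module_S\<^sub>R: "module R S\<^sub>R"
  by (rule module_restricted_ring[OF M.R.is_cring S.is_cring h])

lemma module_B: "module S B"
  by (rule module_base_change[OF module_M S.is_cring h])

sublocale B: module S B by (rule module_B)

lemmas kernel_subgroup = subgroup_tensor_kernel[OF module_M module_S\<^sub>R]

lemma carrier_B_iff:
  "X \<in> carrier B \<longleftrightarrow> (\<exists>x. Poly_Mapping.keys x \<subseteq> carrier M \<times> carrier S \<and> X = coset x)"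
proof -
  have "carrier B = (\<lambda>x. coset x) ` {x. Poly_Mapping.keys x \<subseteq> carrier M \<times> carrier S}"
    unfolding base_change_def Let_def tensor_module_def
    by (simp add: carrier_FactGroup) (simp add: free_Abelian_group_def)
  then show ?thesis by blast
qed

lemma zero_B: "\<zero>\<^bsub>B\<^esub> = coset 0"
proof -
  have "coset 0 = tensor_kernel R M S\<^sub>R" by (auto simp: mem_coset_free_Abelian_group)
  then show ?thesis by (simp add: base_change_def Let_def tensor_module_def)
qed

lemma coset_eq_iff: "coset x = coset y \<longleftrightarrow> x - y \<in> tensor_kernel R M S\<^sub>R"
  using coset_eq_free_Abelian_group[OF kernel_subgroup, of x _ y] by simp

lemma add_B:
  assumes "Poly_Mapping.keys x \<subseteq> carrier M \<times> carrier S" "Poly_Mapping.keys y \<subseteq> carrier M \<times> carrier S"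
  shows "coset x \<oplus>\<^bsub>B\<^esub> coset y = coset (x + y)"
proof -
  interpret P: comm_group "pair_group M S\<^sub>R" by (rule abelian_free_Abelian_group)
  interpret normal "tensor_kernel R M S\<^sub>R" "pair_group M S\<^sub>R"
    by (rule P.subgroup_imp_normal[OF kernel_subgroup])
  show ?thesis using rcos_sum[of x y] assms
    by (simp add: base_change_def Let_def tensor_module_def)
qed

lemma smult_B:
  assumes "s \<in> carrier S"
  shows "s \<odot>\<^bsub>B\<^esub> coset x = coset (frag_extend (\<lambda>(m, t). frag_of (m, s \<otimes>\<^bsub>S\<^esub> t)) x)"
proof -
  have "(\<lambda>t. s \<otimes>\<^bsub>S\<^esub> t) \<in> mod_hom R S\<^sub>R S\<^sub>R"
    using assms h by (auto simp: mod_hom_def S.r_distr ring_hom_closed S.m_lcomm)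
  from tensor_map_coset[OF module_M module_S\<^sub>R module_M module_S\<^sub>R mod_hom_id this, of x]
  show ?thesis by (simp add: base_change_def Let_def)
qed

lemma pure_closed [simp, intro]:
  "m \<in> carrier M \<Longrightarrow> t \<in> carrier S \<Longrightarrow> pure m t \<in> carrier B"
  unfolding carrier_B_iff pure_tensor_def by (intro exI[of _ "frag_of (m, t)"]) simp

lemma smult_pure: "s \<in> carrier S \<Longrightarrow> s \<odot>\<^bsub>B\<^esub> pure m t = pure m (s \<otimes>\<^bsub>S\<^esub> t)"
  by (simp add: pure_tensor_def smult_B)

lemma pure_add_left:
  assumes "m \<in> carrier M" "m' \<in> carrier M" "t \<in> carrier S"
  shows "pure (m \<oplus>\<^bsub>M\<^esub> m') t = pure m t \<oplus>\<^bsub>B\<^esub> pure m' t"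
  using assms tensor_kernel_rel(1)[OF module_M module_S\<^sub>R, of m m' t]
  by (simp add: pure_tensor_def add_B coset_eq_iff algebra_simps)

lemma pure_smult_left:
  assumes "r \<in> carrier R" "m \<in> carrier M" "t \<in> carrier S"
  shows "pure (r \<odot>\<^bsub>M\<^esub> m) t = pure m (h r \<otimes>\<^bsub>S\<^esub> t)"
  using assms tensor_kernel_rel(3)[OF module_M module_S\<^sub>R, of r m t]
  by (simp add: pure_tensor_def coset_eq_iff)

lemma pure_one_hom: "(\<lambda>m. pure m \<one>\<^bsub>S\<^esub>) \<in> mod_hom R M (restrict_scalars h B)"
  using ring_hom_closed[OF h]
  by (auto simp: mod_hom_def pure_add_left pure_smult_left smult_pure)

text \<open>Pure tensors generate the base change as an additive group, and closure under
  differences covers zero, negatives and sums. The scalars need no case of their own, since they can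
  be moved into the second factor.\<close>

lemma base_change_induct [consumes 1, case_names pure diff]:
  assumes "X \<in> carrier B"
    and pure: "\<And>m t. m \<in> carrier M \<Longrightarrow> t \<in> carrier S \<Longrightarrow> Q (pure m t)"
    and diff: "\<And>X Y. X \<in> carrier B \<Longrightarrow> Y \<in> carrier B \<Longrightarrow> Q X \<Longrightarrow> Q Y \<Longrightarrow> Q (X \<ominus>\<^bsub>B\<^esub> Y)"
  shows "Q X"
proof -
  obtain x where x: "Poly_Mapping.keys x \<subseteq> carrier M \<times> carrier S" "X = coset x"
    using assms(1) by (auto simp: carrier_B_iff)
  \<comment> \<open>The support is carried along because the difference case of
    \<open>frag_induction\<close> supplies only the induction hypotheses for the two parts, whose
    cosets must be known to lie in \<open>B\<close>.\<close>
  have "Poly_Mapping.keys x \<subseteq> carrier M \<times> carrier S \<and> Q (coset x)"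
    using x(1)
  proof (induction x rule: frag_induction)
    case zero
    have "Q (pure \<zero>\<^bsub>M\<^esub> \<zero>\<^bsub>S\<^esub> \<ominus>\<^bsub>B\<^esub> pure \<zero>\<^bsub>M\<^esub> \<zero>\<^bsub>S\<^esub>)"
      by (intro diff pure pure_closed) auto
    then show ?case by (simp add: a_minus_def B.M.r_neg flip: zero_B)
  next
    case (one p)
    then show ?case using pure by (cases p) (auto simp: pure_tensor_def)
  next
    case (diff x y)
    then have k: "Poly_Mapping.keys (x - y) \<subseteq> carrier M \<times> carrier S" using keys_diff[of x y] by blast
    have "coset (x - y) \<oplus>\<^bsub>B\<^esub> coset y = coset x" using diff k by (simp add: add_B)
    moreover have c: "coset x \<in> carrier B" "coset y \<in> carrier B" "coset (x - y) \<in> carrier B"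
      using diff k carrier_B_iff by blast+
    ultimately have "coset (x - y) = coset x \<ominus>\<^bsub>B\<^esub> coset y"
      by (simp add: a_minus_def B.M.add.inv_solve_right)
    then show ?case using diff k assms(3)[OF c(1,2)] by simp
  qed
  then show ?thesis using x by simp
qed

section \<open>Maps out of the base change, and base change of projective modules\<close>

lemma base_change_hom_eqI:
  assumes N: "module S N" and f: "f \<in> mod_hom S B N" and g: "g \<in> mod_hom S B N"
    and eq: "\<And>m. m \<in> carrier M \<Longrightarrow> f (pure m \<one>\<^bsub>S\<^esub>) = g (pure m \<one>\<^bsub>S\<^esub>)"
    and X: "X \<in> carrier B"
  shows "f X = g X"
  using X
proof (induction X rule: base_change_induct)
  case (pure m t)
  then have "pure m t = t \<odot>\<^bsub>B\<^esub> pure m \<one>\<^bsub>S\<^esub>" by (simp add: smult_pure)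
  with pure eq show ?case by (simp add: mod_homD(3)[OF f] mod_homD(3)[OF g])
next
  case (diff X Y)
  then show ?case by (simp add: mod_hom_minus(2)[OF module_B N f] mod_hom_minus(2)[OF module_B N g])
qed

text \<open>The balanced map sends (m, t) to t times \<open>l m\<close>. With the zero subgroup as
  \<open>W\<close> it vanishes on the relations and so factors through the quotient. This yields
  only an additive map; \<open>S\<close>-linearity is then checked on pure tensors.\<close>

lemma base_change_universal:
  assumes N: "module S N" and l: "l \<in> mod_hom R M (restrict_scalars h N)"
  obtains f where "f \<in> mod_hom S B N"
    and "\<And>m. m \<in> carrier M \<Longrightarrow> f (pure m \<one>\<^bsub>S\<^esub>) = l m"
proof -
  interpret N: module S N by fact
  have A: "comm_group (add_monoid N)" by (rule N.M.a_comm_group)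
  have W: "subgroup {\<zero>\<^bsub>N\<^esub>} (add_monoid N)" using group.triv_subgroup[OF comm_group.axioms(2)[OF A]] by simp
  have lc: "l m \<in> carrier N" if "m \<in> carrier M" for m using mod_homD(1)[OF l that] by simp
  note hc = ring_hom_closed[OF h]
  obtain \<psi> where \<psi>: "\<psi> \<in> hom (pair_group M S\<^sub>R) (add_monoid N)"
    and \<psi>_of: "\<And>m t. m \<in> carrier M \<Longrightarrow> t \<in> carrier S\<^sub>R \<Longrightarrow> \<psi> (frag_of (m, t)) = t \<odot>\<^bsub>N\<^esub> l m"
    and \<psi>0: "\<And>z. z \<in> tensor_kernel R M S\<^sub>R \<Longrightarrow> \<psi> z \<in> {\<zero>\<^bsub>N\<^esub>}"
  proof (rule tensor_kernel_universal[OF module_M module_S\<^sub>R A W, where b = "\<lambda>m t. t \<odot>\<^bsub>N\<^esub> l m"])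
    fix r m t assume "r \<in> carrier R" "m \<in> carrier M" "t \<in> carrier S\<^sub>R"
    then show "\<exists>w\<in>{\<zero>\<^bsub>N\<^esub>}. t \<odot>\<^bsub>N\<^esub> l (r \<odot>\<^bsub>M\<^esub> m) = (r \<odot>\<^bsub>S\<^sub>R\<^esub> t) \<odot>\<^bsub>N\<^esub> l m \<otimes>\<^bsub>add_monoid N\<^esub> w"
      by (simp add: mod_homD(3)[OF l] lc hc N.smult_assoc1[symmetric] S.m_comm)
  qed (auto simp: mod_homD(2)[OF l] lc N.smult_r_distr N.smult_l_distr)
  interpret \<psi>: group_hom "pair_group M S\<^sub>R" "add_monoid N" \<psi>
    using \<psi> by (simp add: group_hom_def group_hom_axioms_def N.M.a_group)
  have normal: "tensor_kernel R M S\<^sub>R \<lhd> pair_group M S\<^sub>R"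
    by (rule comm_group.subgroup_imp_normal[OF abelian_free_Abelian_group kernel_subgroup])
  have ker: "tensor_kernel R M S\<^sub>R \<subseteq> kernel (pair_group M S\<^sub>R) (add_monoid N) \<psi>"
  proof
    fix z assume z: "z \<in> tensor_kernel R M S\<^sub>R"
    show "z \<in> kernel (pair_group M S\<^sub>R) (add_monoid N) \<psi>"
      using \<psi>0[OF z] subsetD[OF subgroup.subset[OF kernel_subgroup] z] by (simp add: kernel_def)
  qed
  obtain f where f: "f \<in> hom (pair_group M S\<^sub>R Mod tensor_kernel R M S\<^sub>R) (add_monoid N)"
    and "\<And>x. x \<in> carrier (pair_group M S\<^sub>R) \<Longrightarrow>
      f (tensor_kernel R M S\<^sub>R #>\<^bsub>pair_group M S\<^sub>R\<^esub> x) = \<psi> x"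
    by (rule \<psi>.FactGroup_universal_kernel[OF normal ker]) (rule that)
  then have f_coset: "f (coset x) = \<psi> x" if "x \<in> carrier (pair_group M S\<^sub>R)" for x
    using that by simp
  have f_pure: "f (pure m t) = t \<odot>\<^bsub>N\<^esub> l m" if "m \<in> carrier M" "t \<in> carrier S" for m t
    using that f_coset[of "frag_of (m, t)"] by (simp add: pure_tensor_def \<psi>_of)
  have fc: "f X \<in> carrier N" if "X \<in> carrier B" for X
    using that f_coset \<psi>.hom_closed by (auto simp: carrier_B_iff)
  have f_add: "f (X \<oplus>\<^bsub>B\<^esub> Y) = f X \<oplus>\<^bsub>N\<^esub> f Y" if XY: "X \<in> carrier B" "Y \<in> carrier B" for X Y
    using XY hom_mult[OF f, of X Y] by (simp add: base_change_def Let_def tensor_module_def)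
  have f_diff: "f (X \<ominus>\<^bsub>B\<^esub> Y) = f X \<ominus>\<^bsub>N\<^esub> f Y" if XY: "X \<in> carrier B" "Y \<in> carrier B" for X Y
  proof -
    have "f X = f (X \<ominus>\<^bsub>B\<^esub> Y) \<oplus>\<^bsub>N\<^esub> f Y"
      using XY by (simp add: f_add[symmetric] a_minus_def B.M.a_assoc B.M.l_neg)
    then show ?thesis using XY fc by (simp add: a_minus_def N.M.a_assoc N.M.r_neg)
  qed
  have f_smult: "f (s \<odot>\<^bsub>B\<^esub> X) = s \<odot>\<^bsub>N\<^esub> f X" if s: "s \<in> carrier S" and X: "X \<in> carrier B" for s X
    using X
  proof (induction X rule: base_change_induct)
    case (pure m t)
    then show ?case using s by (simp add: smult_pure f_pure N.smult_assoc1 lc)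
  next
    case (diff X Y)
    have "f (s \<odot>\<^bsub>B\<^esub> (X \<ominus>\<^bsub>B\<^esub> Y)) = f (s \<odot>\<^bsub>B\<^esub> X \<ominus>\<^bsub>B\<^esub> s \<odot>\<^bsub>B\<^esub> Y)"
      using diff s by (simp add: a_minus_def B.smult_r_distr B.smult_r_minus)
    then show ?case using diff s fc
      by (simp add: f_diff) (simp add: a_minus_def N.smult_r_distr N.smult_r_minus)
  qed
  have "f \<in> mod_hom S B N" using fc f_add f_smult by (simp add: mod_hom_def)
  moreover have "f (pure m \<one>\<^bsub>S\<^esub>) = l m" if "m \<in> carrier M" for m
    using that by (simp add: f_pure lc)
  ultimately show thesis by (rule that)
qed

text \<open>Restricting \<open>f\<close> along m \<mapsto> m \<otimes> 1 gives a lifting problem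
  over \<open>R\<close>, at types covered by \<open>projective_module_lifts\<close>. Its solution
  extends to \<open>B\<close>, and the extension lifts \<open>f\<close> because maps out of
  \<open>B\<close> are determined on the elements m \<otimes> 1.\<close>

theorem projective_base_change:
  assumes "projective_module R M"
  shows "projective_module S B"
  unfolding projective_module_def
proof (intro conjI allI impI module_B)
  fix N :: "('s, ('m \<times> 's \<Rightarrow>\<^sub>0 int) set \<Rightarrow> 's) module" and P :: "('s, ('m \<times> 's \<Rightarrow>\<^sub>0 int) set) module"
  assume N: "module S N" and P: "module S P"
  note rs = module_restrict_scalars[OF M.R.is_cring h]
  show "lifts_through S B N P"
    unfolding lifts_through_def
  proof (intro ballI impI)
    fix g f assume g: "g \<in> mod_hom S N P" and f: "f \<in> mod_hom S B P"
      and surj: "g ` carrier N = carrier P"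
    have "lifts_through R M (restrict_scalars h N) (restrict_scalars h P)"
      by (rule projective_module_lifts[OF assms rs[OF N] rs[OF P]])
    moreover have "(\<lambda>m. f (pure m \<one>\<^bsub>S\<^esub>)) \<in> mod_hom R M (restrict_scalars h P)"
      by (rule mod_hom_compose[OF pure_one_hom mod_hom_restrict_scalars[OF h f]])
    ultimately obtain l where l: "l \<in> mod_hom R M (restrict_scalars h N)"
      and gl: "\<And>m. m \<in> carrier M \<Longrightarrow> g (l m) = f (pure m \<one>\<^bsub>S\<^esub>)"
      unfolding lifts_through_def
      using mod_hom_restrict_scalars[OF h g] surj by fastforce
    obtain k where k: "k \<in> mod_hom S B N"
      and kl: "\<And>m. m \<in> carrier M \<Longrightarrow> k (pure m \<one>\<^bsub>S\<^esub>) = l m"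
      using base_change_universal[OF N l] by blast
    have "g (k X) = f X" if "X \<in> carrier B" for X
      by (rule base_change_hom_eqI[OF P mod_hom_compose[OF k g] f _ that]) (simp add: kl gl)
    with k show "\<exists>l\<in>mod_hom S B N. \<forall>x\<in>carrier B. g (l x) = f x" by blast
  qed
qed

section \<open>Presentations under base change and their kernels\<close>

text \<open>Names an explicit representative of the combination, so that its vanishing can be read
  as membership in \<open>tensor_kernel\<close>.\<close>

lemma free_eval_pure:
  assumes I: "finite I" and p: "p \<in> I \<rightarrow> carrier M" and v: "v \<in> carrier (free_mod S I)"
  shows "free_eval S B (\<lambda>i. pure (p i) \<one>\<^bsub>S\<^esub>) v = coset (\<Sum>i\<in>I. frag_of (p i, v i))"
proof -
  note c = free_mod_car(1)[OF S.is_cring v]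
  have "(\<Oplus>\<^bsub>B\<^esub>i\<in>J. v i \<odot>\<^bsub>B\<^esub> pure (p i) \<one>\<^bsub>S\<^esub>) = coset (\<Sum>i\<in>J. frag_of (p i, v i))"
    if "finite J" "J \<subseteq> I" for J
    using that
  proof (induction J)
    case empty then show ?case by (simp add: zero_B)
  next
    case (insert j J)
    have pc: "p i \<in> carrier M" if "i \<in> insert j J" for i using p insert.prems that by blast
    have "(\<Sum>i\<in>J. frag_of (p i, v i)) \<in> carrier (free_Abelian_group (carrier M \<times> carrier S))"
      using pc c by (intro sum_closed_free_Abelian_group) auto
    then have k: "Poly_Mapping.keys (\<Sum>i\<in>J. frag_of (p i, v i)) \<subseteq> carrier M \<times> carrier S" by simp
    have "(\<Oplus>\<^bsub>B\<^esub>i\<in>insert j J. v i \<odot>\<^bsub>B\<^esub> pure (p i) \<one>\<^bsub>S\<^esub>)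
      = v j \<odot>\<^bsub>B\<^esub> pure (p j) \<one>\<^bsub>S\<^esub> \<oplus>\<^bsub>B\<^esub> (\<Oplus>\<^bsub>B\<^esub>i\<in>J. v i \<odot>\<^bsub>B\<^esub> pure (p i) \<one>\<^bsub>S\<^esub>)"
      using insert pc c by (intro B.M.finsum_insert) auto
    also have "\<dots> = coset (frag_of (p j, v j)) \<oplus>\<^bsub>B\<^esub> coset (\<Sum>i\<in>J. frag_of (p i, v i))"
      using insert c by (simp add: smult_pure) (simp add: pure_tensor_def)
    also have "\<dots> = coset (\<Sum>i\<in>insert j J. frag_of (p i, v i))"
      using insert.hyps pc c k by (subst add_B) auto
    finally show ?case .
  qed
  moreover have "free_eval S B (\<lambda>i. pure (p i) \<one>\<^bsub>S\<^esub>) v = (\<Oplus>\<^bsub>B\<^esub>i\<in>I. v i \<odot>\<^bsub>B\<^esub> pure (p i) \<one>\<^bsub>S\<^esub>)"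
    using p free_mod_car(3)[OF S.is_cring v] by (intro free_eval_superset[OF module_B v _ I]) auto
  ultimately show ?thesis using I by simp
qed

lemma h_zero: "h \<zero>\<^bsub>R\<^esub> = \<zero>\<^bsub>S\<^esub>"
  by (rule ring_hom_zero[OF h M.R.ring_axioms S.ring_axioms])

lemma free_mod_extend: "(\<lambda>v. h \<circ> v) \<in> mod_hom R (free_mod R I) (restrict_scalars h (free_mod S I))"
proof -
  note c = free_mod_car[OF M.R.is_cring]
  note hc = ring_hom_closed[OF h] ring_hom_add[OF h] ring_hom_mult[OF h]
  have closed: "h \<circ> v \<in> carrier (free_mod S I)" if v: "v \<in> carrier (free_mod R I)" for v
  proof -
    have "{i. h (v i) \<noteq> \<zero>\<^bsub>S\<^esub>} \<subseteq> {i. v i \<noteq> \<zero>\<^bsub>R\<^esub>}" using h_zero by auto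
    then have "finite {i. h (v i) \<noteq> \<zero>\<^bsub>S\<^esub>}" by (rule finite_subset) (rule c(2)[OF v])
    moreover have "h (v i) \<in> carrier S" for i using c(1)[OF v] hc by blast
    moreover have "h (v i) = \<zero>\<^bsub>S\<^esub>" if "i \<notin> I" for i using c(3)[OF v, of i] that h_zero by metis
    ultimately show ?thesis by (simp add: free_mod_def)
  qed
  have "h \<circ> (v \<oplus>\<^bsub>free_mod R I\<^esub> w) = (h \<circ> v) \<oplus>\<^bsub>free_mod S I\<^esub> (h \<circ> w)"
    if "v \<in> carrier (free_mod R I)" "w \<in> carrier (free_mod R I)" for v w
    using c(1)[OF that(1)] c(1)[OF that(2)] hc by (simp add: free_mod_def fun_eq_iff)
  moreover have "h \<circ> (r \<odot>\<^bsub>free_mod R I\<^esub> v) = h r \<odot>\<^bsub>free_mod S I\<^esub> (h \<circ> v)"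
    if "r \<in> carrier R" "v \<in> carrier (free_mod R I)" for r v
    using that(1) c(1)[OF that(2)] hc by (simp add: free_mod_def fun_eq_iff)
  ultimately show ?thesis using closed by (simp add: mod_hom_def)
qed

lemma extend_free_unit: "h \<circ> free_unit R i = free_unit S i"
  using h_zero ring_hom_one[OF h] by (simp add: free_unit_def fun_eq_iff)

text \<open>Both ways around the square from the free \<open>R\<close>-module to \<open>B\<close>
  are \<open>R\<close>-linear and agree on the standard basis.\<close>

lemma free_eval_pure_extend:
  assumes p: "p \<in> I \<rightarrow> carrier M" and v: "v \<in> carrier (free_mod R I)"
  shows "free_eval S B (\<lambda>i. pure (p i) \<one>\<^bsub>S\<^esub>) (h \<circ> v) = pure (free_eval R M p v) \<one>\<^bsub>S\<^esub>"
proof -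
  have pp: "(\<lambda>i. pure (p i) \<one>\<^bsub>S\<^esub>) \<in> I \<rightarrow> carrier B" using p by auto
  show ?thesis
  proof (rule free_mod_hom_eqI[OF module_restrict_scalars[OF M.R.is_cring h module_B] _ _ _ v])
    show "(\<lambda>v. free_eval S B (\<lambda>i. pure (p i) \<one>\<^bsub>S\<^esub>) (h \<circ> v))
      \<in> mod_hom R (free_mod R I) (restrict_scalars h B)"
      by (rule mod_hom_compose[OF free_mod_extend
          mod_hom_restrict_scalars[OF h free_eval_hom[OF module_B pp]]])
    show "(\<lambda>v. pure (free_eval R M p v) \<one>\<^bsub>S\<^esub>) \<in> mod_hom R (free_mod R I) (restrict_scalars h B)"
      by (rule mod_hom_compose[OF free_eval_hom[OF module_M p] pure_one_hom])
    show "free_eval S B (\<lambda>i. pure (p i) \<one>\<^bsub>S\<^esub>) (h \<circ> free_unit R i)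
      = pure (free_eval R M p (free_unit R i)) \<one>\<^bsub>S\<^esub>" if "i \<in> I" for i
      using free_eval_unit[OF module_B that pp] free_eval_unit[OF module_M that p]
      by (simp add: extend_free_unit)
  qed
qed

text \<open>
  The kernel element \<open>v\<close> is in the \<open>S\<close>-span of the image of finitely many elements of the kernel
  over \<open>R\<close>. Stating this in terms of the endomorphisms that kill these elements avoids spans.
\<close>

lemma base_change_kernel:
  assumes I: "finite I" and p: "p \<in> I \<rightarrow> carrier M"
    and gen: "free_eval R M p ` carrier (free_mod R I) = carrier M"
    and v: "v \<in> carrier (free_mod S I)"
    and v0: "free_eval S B (\<lambda>i. pure (p i) \<one>\<^bsub>S\<^esub>) v = \<zero>\<^bsub>B\<^esub>"
  shows "\<exists>Y. finite Y \<and> Y \<subseteq> {k \<in> carrier (free_mod R I). free_eval R M p k = \<zero>\<^bsub>M\<^esub>} \<and>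
    (\<forall>f\<in>mod_hom S (free_mod S I) (free_mod S I).
       (\<forall>y\<in>Y. f (h \<circ> y) = \<zero>\<^bsub>free_mod S I\<^esub>) \<longrightarrow> f v = \<zero>\<^bsub>free_mod S I\<^esub>)"
proof -
  let ?F = "free_mod R I" and ?G = "free_mod S I"
  define \<pi> where "\<pi> = free_eval R M p"
  define K where "K = {k \<in> carrier ?F. \<pi> k = \<zero>\<^bsub>M\<^esub>}"
  define controls where "controls Y w \<longleftrightarrow>
    (\<forall>f\<in>mod_hom S ?G ?G. (\<forall>y\<in>Y. f (h \<circ> y) = \<zero>\<^bsub>?G\<^esub>) \<longrightarrow> f w = \<zero>\<^bsub>?G\<^esub>)" for Y w
  \<comment> \<open>Each element has its own finite set. A sum is controlled by the union of two
    such sets, which is what makes \<open>W\<close> a subgroup.\<close>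
  define W where "W = {w \<in> carrier ?G. \<exists>Y. finite Y \<and> Y \<subseteq> K \<and> controls Y w}"
  have F: "module R ?F" by (rule module_free_mod[OF M.R.is_cring])
  have G: "module S ?G" by (rule module_free_mod[OF S.is_cring])
  interpret F: module R ?F by (rule F)
  interpret G: module S ?G by (rule G)
  have \<pi>: "\<pi> \<in> mod_hom R ?F M" unfolding \<pi>_def by (rule free_eval_hom[OF module_M p])
  note ext = mod_homD[OF free_mod_extend[of I], simplified]
  have W: "subgroup W (add_monoid ?G)"
  proof (rule subgroup.intro)
    show "W \<subseteq> carrier (add_monoid ?G)" by (auto simp: W_def)
    show "\<one>\<^bsub>add_monoid ?G\<^esub> \<in> W"
      using mod_hom_zero[OF G G] by (auto simp: W_def controls_def intro!: exI[of _ "{}"])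
  next
    fix x y assume "x \<in> W" "y \<in> W"
    then obtain X Y where X: "finite X" "X \<subseteq> K" "controls X x" "x \<in> carrier ?G"
      and Y: "finite Y" "Y \<subseteq> K" "controls Y y" "y \<in> carrier ?G"
      unfolding W_def by auto
    have "controls (X \<union> Y) (x \<oplus>\<^bsub>?G\<^esub> y)"
      using X(3,4) Y(3,4) by (auto simp: controls_def mod_homD(2))
    then show "x \<otimes>\<^bsub>add_monoid ?G\<^esub> y \<in> W"
      using X Y unfolding W_def by (intro CollectI conjI exI[of _ "X \<union> Y"]) auto
  next
    fix x assume "x \<in> W"
    then obtain X where X: "finite X" "X \<subseteq> K" "controls X x" "x \<in> carrier ?G"
      unfolding W_def by auto
    have "controls X (\<ominus>\<^bsub>?G\<^esub> x)"
      using X(3,4) by (auto simp: controls_def mod_hom_minus(1)[OF G G])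
    then have "\<ominus>\<^bsub>?G\<^esub> x \<in> W" using X unfolding W_def by auto
    then show "inv\<^bsub>add_monoid ?G\<^esub> x \<in> W" by (simp add: a_inv_def)
  qed
  have kW: "t \<odot>\<^bsub>?G\<^esub> (h \<circ> k) \<in> W" if "k \<in> K" "t \<in> carrier S" for k t
  proof -
    have "h \<circ> k \<in> carrier ?G" using that(1) ext(1) by (simp add: K_def)
    then show ?thesis using that unfolding W_def
      by (intro CollectI conjI exI[of _ "{k}"]) (auto simp: controls_def mod_homD(3))
  qed
  \<comment> \<open>Two preimages of the same element differ by an element of \<open>K\<close>.
    Hence the map \<open>s\<close> below, a bare choice of preimages, behaves linearly modulo
    \<open>W\<close>.\<close>
  have diff: "\<exists>w\<in>W. t \<odot>\<^bsub>?G\<^esub> (h \<circ> a) = t \<odot>\<^bsub>?G\<^esub> (h \<circ> b) \<oplus>\<^bsub>?G\<^esub> w"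
    if a: "a \<in> carrier ?F" and b: "b \<in> carrier ?F" and "\<pi> a = \<pi> b" and t: "t \<in> carrier S" for a b t
  proof -
    let ?k = "a \<ominus>\<^bsub>?F\<^esub> b"
    have "?k \<in> K" using that by (simp add: K_def mod_hom_minus_eq_zero[OF F module_M \<pi>])
    moreover have "a = b \<oplus>\<^bsub>?F\<^esub> ?k" using a b by (simp add: F.M.add_diff_cancel)
    then have "h \<circ> a = (h \<circ> b) \<oplus>\<^bsub>?G\<^esub> (h \<circ> ?k)" using ext(2)[OF b F.M.minus_closed[OF a b]] by simp
    ultimately show ?thesis
      using kW[OF _ t] t ext(1)[OF b] ext(1)[OF F.M.minus_closed[OF a b]]
      by (intro bexI[of _ "t \<odot>\<^bsub>?G\<^esub> (h \<circ> ?k)"]) (simp_all add: G.smult_r_distr)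
  qed
  define s where "s = inv_into (carrier ?F) \<pi>"
  have s: "s m \<in> carrier ?F \<and> \<pi> (s m) = m" if "m \<in> carrier M" for m
    using that gen by (simp add: s_def \<pi>_def inv_into_into f_inv_into_f)
  note zeroW = subgroup.one_closed[OF W]
  obtain \<psi> where \<psi>: "\<psi> \<in> hom (pair_group M S\<^sub>R) (add_monoid ?G)"
    and \<psi>_of: "\<And>m t. m \<in> carrier M \<Longrightarrow> t \<in> carrier S\<^sub>R \<Longrightarrow>
      \<psi> (frag_of (m, t)) = t \<odot>\<^bsub>?G\<^esub> (h \<circ> s m)"
    and \<psi>W: "\<And>z. z \<in> tensor_kernel R M S\<^sub>R \<Longrightarrow> \<psi> z \<in> W"
  proof (rule tensor_kernel_universal[OF module_M module_S\<^sub>R G.M.a_comm_group W,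
        where b = "\<lambda>m t. t \<odot>\<^bsub>?G\<^esub> (h \<circ> s m)"])
    fix m t assume "m \<in> carrier M" "t \<in> carrier S\<^sub>R"
    then show "t \<odot>\<^bsub>?G\<^esub> (h \<circ> s m) \<in> carrier (add_monoid ?G)" using s ext(1) by simp
  next
    fix m m' t assume c: "m \<in> carrier M" "m' \<in> carrier M" "t \<in> carrier S\<^sub>R"
    then have "\<exists>w\<in>W. t \<odot>\<^bsub>?G\<^esub> (h \<circ> s (m \<oplus>\<^bsub>M\<^esub> m')) = t \<odot>\<^bsub>?G\<^esub> (h \<circ> (s m \<oplus>\<^bsub>?F\<^esub> s m')) \<oplus>\<^bsub>?G\<^esub> w"
      using s by (intro diff) (auto simp: mod_homD(2)[OF \<pi>])
    then show "\<exists>w\<in>W. t \<odot>\<^bsub>?G\<^esub> (h \<circ> s (m \<oplus>\<^bsub>M\<^esub> m')) = t \<odot>\<^bsub>?G\<^esub> (h \<circ> s m)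
        \<otimes>\<^bsub>add_monoid ?G\<^esub> (t \<odot>\<^bsub>?G\<^esub> (h \<circ> s m')) \<otimes>\<^bsub>add_monoid ?G\<^esub> w"
      using c s ext by (simp add: G.smult_r_distr)
  next
    fix m t t' assume c: "m \<in> carrier M" "t \<in> carrier S\<^sub>R" "t' \<in> carrier S\<^sub>R"
    then show "\<exists>w\<in>W. (t \<oplus>\<^bsub>S\<^sub>R\<^esub> t') \<odot>\<^bsub>?G\<^esub> (h \<circ> s m) = t \<odot>\<^bsub>?G\<^esub> (h \<circ> s m)
        \<otimes>\<^bsub>add_monoid ?G\<^esub> (t' \<odot>\<^bsub>?G\<^esub> (h \<circ> s m)) \<otimes>\<^bsub>add_monoid ?G\<^esub> w"
      using s ext(1) zeroW by (intro bexI[of _ "\<zero>\<^bsub>?G\<^esub>"]) (auto simp: G.smult_l_distr)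
  next
    fix r m t assume c: "r \<in> carrier R" "m \<in> carrier M" "t \<in> carrier S\<^sub>R"
    then have "\<exists>w\<in>W. t \<odot>\<^bsub>?G\<^esub> (h \<circ> s (r \<odot>\<^bsub>M\<^esub> m)) = t \<odot>\<^bsub>?G\<^esub> (h \<circ> (r \<odot>\<^bsub>?F\<^esub> s m)) \<oplus>\<^bsub>?G\<^esub> w"
      using s by (intro diff) (auto simp: mod_homD(3)[OF \<pi>])
    then show "\<exists>w\<in>W. t \<odot>\<^bsub>?G\<^esub> (h \<circ> s (r \<odot>\<^bsub>M\<^esub> m))
        = (r \<odot>\<^bsub>S\<^sub>R\<^esub> t) \<odot>\<^bsub>?G\<^esub> (h \<circ> s m) \<otimes>\<^bsub>add_monoid ?G\<^esub> w"
      using c s ext ring_hom_closed[OF h] by (simp add: S.m_comm G.smult_assoc1)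
  qed (rule that)
  \<comment> \<open>\<open>z\<close> represents the image of \<open>v\<close> in \<open>B\<close>,
    which is zero, so \<open>z\<close> lies in \<open>tensor_kernel\<close> and \<psi> sends it into
    \<open>W\<close>.\<close>
  define z where "z = (\<Sum>i\<in>I. frag_of (p i, v i))"
  note c = free_mod_car[OF S.is_cring v]
  have "coset z = coset 0" using free_eval_pure[OF I p v] v0 by (simp add: z_def zero_B)
  then have "\<psi> z \<in> W" by (intro \<psi>W) (simp add: coset_eq_iff)
  have sp: "(\<lambda>i. h \<circ> s (p i)) \<in> I \<rightarrow> carrier ?G" using p s ext(1) by auto
  have "\<psi> z = (\<Otimes>\<^bsub>add_monoid ?G\<^esub>i\<in>I. \<psi> (frag_of (p i, v i)))"
    unfolding z_def using p c(1) by (intro hom_pair_group_sum[OF G.M.a_comm_group \<psi> I]) auto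
  also have "\<dots> = (\<Oplus>\<^bsub>?G\<^esub>i\<in>I. v i \<odot>\<^bsub>?G\<^esub> (h \<circ> s (p i)))"
    unfolding finsum_def using p c(1) sp
    by (intro comm_monoid.finprod_cong'[OF G.M.a_comm_monoid]) (auto simp: \<psi>_of Pi_iff)
  also have "\<dots> = free_eval S ?G (\<lambda>i. h \<circ> s (p i)) v"
    using c(3) by (intro free_eval_superset[OF G v sp I, symmetric]) auto
  finally have \<psi>z: "\<psi> z = free_eval S ?G (\<lambda>i. h \<circ> s (p i)) v" .
  from \<open>\<psi> z \<in> W\<close> obtain Y0 where Y0: "finite Y0" "Y0 \<subseteq> K" "controls Y0 (\<psi> z)"
    unfolding W_def by auto
  \<comment> \<open>The value \<psi>(z) is the combination of the images of \<open>s (p i)\<close>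
    with coefficients \<open>v i\<close>, whereas \<open>v\<close> is that of the basis vectors. The
    discrepancy comes from the \<open>y i\<close>, which lie in \<open>K\<close> because both
    preimages lie over \<open>p i\<close>; adding them to \<open>Y0\<close> removes it.\<close>
  define y where "y i = s (p i) \<ominus>\<^bsub>?F\<^esub> free_unit R i" for i
  have u: "free_unit R i \<in> carrier ?F" if "i \<in> I" for i by (rule free_unit_mem[OF M.R.is_cring that])
  have yK: "y i \<in> K" if "i \<in> I" for i
  proof -
    have "p i \<in> carrier M" using that p by blast
    then show ?thesis using s[of "p i"] u[OF that] free_eval_unit[OF module_M that p]
      unfolding K_def y_def
      by (intro CollectI conjI F.M.minus_closed mod_hom_minus_eq_zero[OF F module_M \<pi>])
        (auto simp: \<pi>_def)
  qed
  have "f v = \<zero>\<^bsub>?G\<^esub>" if f: "f \<in> mod_hom S ?G ?G" and f0: "\<forall>k\<in>Y0 \<union> y ` I. f (h \<circ> k) = \<zero>\<^bsub>?G\<^esub>" for f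
  proof -
    have "f (free_eval S ?G (\<lambda>i. h \<circ> s (p i)) v) = f v"
    proof (rule free_mod_hom_eqI[OF G mod_hom_compose[OF free_eval_hom[OF G sp] f] f _ v])
      fix i assume i: "i \<in> I"
      then have si: "s (p i) \<in> carrier ?F" using p s by auto
      have "s (p i) = free_unit R i \<oplus>\<^bsub>?F\<^esub> y i"
        using si u[OF i] by (simp add: y_def F.M.add_diff_cancel)
      moreover have yi: "y i \<in> carrier ?F" using yK[OF i] by (simp add: K_def)
      ultimately have "h \<circ> s (p i) = free_unit S i \<oplus>\<^bsub>?G\<^esub> (h \<circ> y i)"
        using ext(2)[OF u[OF i] yi] by (simp add: extend_free_unit)
      then have "f (h \<circ> s (p i)) = f (free_unit S i)"
        using f0 i mod_homD(2)[OF f free_unit_mem[OF S.is_cring i] ext(1)[OF yi]]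
          mod_homD(1)[OF f free_unit_mem[OF S.is_cring i]] by simp
      then show "f (free_eval S ?G (\<lambda>i. h \<circ> s (p i)) (free_unit S i)) = f (free_unit S i)"
        using free_eval_unit[OF G i sp] by simp
    qed
    then show ?thesis using Y0(3) f f0 \<psi>z by (simp add: controls_def)
  qed
  then show ?thesis using Y0(1,2) I yK unfolding K_def \<pi>_def by (intro exI[of _ "Y0 \<union> y ` I"]) auto
qed

end

section \<open>Flatness\<close>

text \<open>Flatness makes M \<otimes> H \<rightarrow> M \<otimes> P injective for the inclusion of
  \<open>H\<close>. This map sends the coset of \<open>z\<close> to the coset of the same
  \<open>z\<close>, so injectivity becomes a statement about representatives.\<close>

lemma flat_tensor_kernel_submodule:
  assumes flat: "flat_module R M" and P: "module R P" and H: "module R (P\<lparr>carrier := H\<rparr>)"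
    and sub: "H \<subseteq> carrier P" and z: "z \<in> tensor_kernel R M P"
    and keys: "Poly_Mapping.keys z \<subseteq> carrier M \<times> H"
  shows "z \<in> tensor_kernel R M (P\<lparr>carrier := H\<rparr>)" (is "z \<in> tensor_kernel R M ?H")
proof -
  have M: "module R M" using flat by (simp add: flat_module_def)
  have id: "id \<in> mod_hom R ?H P" using sub by (auto simp: mod_hom_def)
  have "tensor_preserves_inj R M ?H P" by (rule flat_module_preserves_inj[OF flat H P])
  then have inj: "inj_on (tensor_map R M P id id) (carrier (tensor_module R M ?H))"
    unfolding tensor_preserves_inj_def using id by (auto simp: inj_on_id)
  let ?c = "\<lambda>x. tensor_kernel R M ?H #>\<^bsub>pair_group M ?H\<^esub> x"
  have map: "tensor_map R M P id id (?c x) = tensor_kernel R M P #>\<^bsub>pair_group M P\<^esub> x" for x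
    using tensor_map_coset[OF M H M P mod_hom_id id, of x]
    by (simp add: case_prod_unfold flip: frag_expansion)
  have cc: "?c x \<in> carrier (tensor_module R M ?H)" if "Poly_Mapping.keys x \<subseteq> carrier M \<times> H" for x
    using that by (auto simp: tensor_module_def carrier_FactGroup)
  have "tensor_map R M P id id (?c z) = tensor_map R M P id id (?c 0)"
    using z by (simp only: map coset_eq_free_Abelian_group[OF subgroup_tensor_kernel[OF M P]] diff_0_right)
  then have "?c z = ?c 0"
    by (rule inj_onD[OF inj _ cc[OF keys] cc]) simp
  then show ?thesis
    by (simp only: coset_eq_free_Abelian_group[OF subgroup_tensor_kernel[OF M H]] diff_0_right)
qed

text \<open>
  The relation \<open>\<Sum> k\<^sub>i p\<^sub>i = 0\<close> says that \<open>\<Sum> p\<^sub>i \<otimes> k\<^sub>i\<close> vanishes in \<open>M \<otimes> R\<close>, hence by flatness in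
  \<open>M \<otimes> H\<close>, where \<open>H\<close> is the ideal generated by the \<open>k\<^sub>i\<close>, the image of \<open>\<phi> : F \<rightarrow> R\<close>. Choosing
  \<open>\<phi>\<close>-preimages maps \<open>M \<otimes> H\<close> to \<open>M\<^sup>I\<close> modulo the families \<open>W\<close> induced by endomorphisms of \<open>F\<close> that
  kill \<open>k\<close>, and \<open>\<Sum> p\<^sub>i \<otimes> k\<^sub>i\<close> to the class of \<open>p\<close>.
\<close>

lemma flat_kernel_retraction:
  fixes R :: "('a, 'r) ring_scheme" and M :: "('a, 'm) module"
  assumes flat: "flat_module R M" and I: "finite I" and p: "p \<in> I \<rightarrow> carrier M"
    and gen: "free_eval R M p ` carrier (free_mod R I) = carrier M"
    and k: "k \<in> carrier (free_mod R I)" and k0: "free_eval R M p k = \<zero>\<^bsub>M\<^esub>"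
  shows "\<exists>T\<in>mod_hom R (free_mod R I) (free_mod R I). T k = \<zero>\<^bsub>free_mod R I\<^esub> \<and>
    (\<forall>v\<in>carrier (free_mod R I). free_eval R M p (T v) = free_eval R M p v)"
proof -
  let ?F = "free_mod R I" and ?R = "restricted_ring R id"
  have M: "module R M" using flat by (simp add: flat_module_def)
  interpret M: module R M by fact
  have id: "id \<in> ring_hom R R" by (simp add: ring_hom_def)
  \<comment> \<open>The extension along the identity provides the calculation in M \<otimes>
    R.\<close>
  interpret E: scalar_extension R M R id
    by (simp add: scalar_extension_def scalar_extension_axioms_def M M.R.is_cring id)
  have F: "module R ?F" by (rule module_free_mod[OF M.R.is_cring])
  interpret F: module R ?F by (rule F)
  have R: "module R ?R" by (rule E.module_S\<^sub>R)
  interpret Rm: module R ?R by (rule R)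
  define \<pi> where "\<pi> = free_eval R M p"
  have \<pi>: "\<pi> \<in> mod_hom R ?F M" unfolding \<pi>_def by (rule free_eval_hom[OF M p])
  note c = free_mod_car(1)[OF M.R.is_cring]
  have vR: "v \<in> I \<rightarrow> carrier ?R" if "v \<in> carrier ?F" for v using c[OF that] by auto
  note e = free_unit_mem[OF M.R.is_cring, of _ I]
  \<comment> \<open>The linear form v \<mapsto> \<Sum> v_i k_i. Its symmetry in \<open>v\<close> and
    \<open>k\<close>, proved as \<open>dual\<close>, later turns \<phi>(l) = 0 into the vanishing at
    \<open>k\<close> of the form defined by \<open>l\<close>.\<close>
  define \<phi> where "\<phi> = free_eval R ?R k"
  have \<phi>: "\<phi> \<in> mod_hom R ?F ?R" unfolding \<phi>_def by (rule free_eval_hom[OF R vR[OF k]])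
  have \<phi>_e: "\<phi> (free_unit R i) = k i" if "i \<in> I" for i
    unfolding \<phi>_def by (rule free_eval_unit[OF R that vR[OF k]])
  have dual: "free_eval R ?R w v = free_eval R ?R v w"
    if "v \<in> carrier ?F" "w \<in> carrier ?F" for v w
  proof -
    have *: "free_eval R ?R w v = (\<Oplus>\<^bsub>?R\<^esub>i\<in>I. v i \<odot>\<^bsub>?R\<^esub> w i)"
      if "v \<in> carrier ?F" "w \<in> carrier ?F" for v w
      using free_mod_car(3)[OF M.R.is_cring that(1)]
      by (intro free_eval_superset[OF R that(1) vR[OF that(2)] I]) auto
    show ?thesis unfolding *[OF that] *[OF that(2,1)]
      using c[OF that(1)] c[OF that(2)] by (intro Rm.M.finsum_cong') (auto simp: M.R.m_comm)
  qed

  define H where "H = \<phi> ` carrier ?F"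
  let ?H = "?R\<lparr>carrier := H\<rparr>"
  have modH: "module R ?H" unfolding H_def by (rule module_image[OF F R \<phi>])
  have kH: "k i \<in> H" if "i \<in> I" for i
    using \<phi>_e[OF that] e[OF that] unfolding H_def by (metis image_eqI)
  define z where "z = (\<Sum>i\<in>I. frag_of (p i, k i))"
  have zH: "z \<in> tensor_kernel R M ?H"
  proof (rule flat_tensor_kernel_submodule[OF flat R modH])
    show "H \<subseteq> carrier ?R" using mod_homD(1)[OF \<phi>] by (auto simp: H_def)
    \<comment> \<open>Moving the coefficients across the tensor sign gives \<Sum> p_i \<otimes> k_i
      = (\<Sum> k_i p_i) \<otimes> 1.\<close>
    have "E.coset z = E.pure \<zero>\<^bsub>M\<^esub> \<one>\<^bsub>R\<^esub>"
      using E.free_eval_pure[OF I p k] E.free_eval_pure_extend[OF p k] k0 by (simp add: z_def)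
    also have "\<dots> = E.coset 0"
      using mod_hom_zero[OF M module_restrict_scalars[OF M.R.is_cring id E.module_B] E.pure_one_hom]
      by (simp add: E.zero_B)
    finally show "z \<in> tensor_kernel R M ?R" by (simp add: E.coset_eq_iff)
    have "z \<in> carrier (free_Abelian_group (carrier M \<times> H))"
      unfolding z_def using p kH by (intro sum_closed_free_Abelian_group) auto
    then show "Poly_Mapping.keys z \<subseteq> carrier M \<times> H" by simp
  qed

  let ?A = "product_group I (\<lambda>_. add_monoid M)"
  have A: "comm_group ?A"
    by (rule group.group_comm_groupI)
      (auto simp: M.M.a_group fun_eq_iff intro!: M.M.a_comm)
  interpret A: comm_group ?A by (rule A)
  \<comment> \<open>The family records \<pi> \<circ> T on the basis, hence determines it. The goal
    is to put the family \<open>p\<close> into \<open>W\<close>: the corresponding \<open>T\<close>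
    kills \<open>k\<close> and satisfies \<pi> \<circ> T = \<pi>.\<close>
  define W where "W = {(\<lambda>i\<in>I. \<pi> (T (free_unit R i))) |T. T \<in> mod_hom R ?F ?F \<and> T k = \<zero>\<^bsub>?F\<^esub>}"
  have WI: "u \<in> W" if "T \<in> mod_hom R ?F ?F" "T k = \<zero>\<^bsub>?F\<^esub>" "u = (\<lambda>i\<in>I. \<pi> (T (free_unit R i)))" for T u
    using that unfolding W_def by auto
  have W: "subgroup W ?A"
  proof (rule subgroup.intro)
    show "W \<subseteq> carrier ?A" using mod_homD(1)[OF \<pi>] e by (auto simp: W_def mod_homD(1))
    show "\<one>\<^bsub>?A\<^esub> \<in> W"
      using mod_hom_zero[OF F M \<pi>] by (intro WI[OF mod_hom_const_zero[OF F]]) auto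
  next
    fix x y assume "x \<in> W" "y \<in> W"
    then obtain T U where T: "T \<in> mod_hom R ?F ?F" "T k = \<zero>\<^bsub>?F\<^esub>" "x = (\<lambda>i\<in>I. \<pi> (T (free_unit R i)))"
      and U: "U \<in> mod_hom R ?F ?F" "U k = \<zero>\<^bsub>?F\<^esub>" "y = (\<lambda>i\<in>I. \<pi> (U (free_unit R i)))"
      unfolding W_def by auto
    show "x \<otimes>\<^bsub>?A\<^esub> y \<in> W"
      using T U e by (intro WI[OF mod_hom_add[OF F T(1) U(1)]])
        (auto simp: mod_homD(1) mod_homD(2)[OF \<pi>])
  next
    fix x assume x: "x \<in> W"
    then obtain T where T: "T \<in> mod_hom R ?F ?F" "T k = \<zero>\<^bsub>?F\<^esub>" "x = (\<lambda>i\<in>I. \<pi> (T (free_unit R i)))"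
      unfolding W_def by auto
    have "inv\<^bsub>?A\<^esub> x = (\<lambda>i\<in>I. \<ominus>\<^bsub>M\<^esub> x i)"
      using T e mod_homD(1)[OF \<pi>]
      by (subst inv_product_group) (auto simp: M.M.a_group a_inv_def mod_homD(1))
    \<comment> \<open>Negation is written as multiplication by -1, so that linearity follows by
      composition.\<close>
    moreover have T': "(\<lambda>v. (\<ominus>\<^bsub>R\<^esub> \<one>\<^bsub>R\<^esub>) \<odot>\<^bsub>?F\<^esub> T v) \<in> mod_hom R ?F ?F"
      by (rule mod_hom_compose[OF T(1) smult_mod_hom[OF F]]) simp
    have "(\<lambda>i\<in>I. \<ominus>\<^bsub>M\<^esub> x i) \<in> W"
      using T e mod_homD(1)[OF \<pi>]
      by (intro WI[OF T']) (auto simp: mod_homD(1) mod_homD(3)[OF \<pi>] M.smult_l_minus)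
    ultimately show "inv\<^bsub>?A\<^esub> x \<in> W" by simp
  qed
  define s where "s = inv_into (carrier ?F) \<pi>"
  have s: "s m \<in> carrier ?F \<and> \<pi> (s m) = m" if "m \<in> carrier M" for m
    using that gen by (simp add: s_def \<pi>_def inv_into_into f_inv_into_f)
  define \<sigma> where "\<sigma> = inv_into (carrier ?F) \<phi>"
  have \<sigma>: "\<sigma> a \<in> carrier ?F \<and> \<phi> (\<sigma> a) = a" if "a \<in> H" for a
    using that by (simp add: \<sigma>_def H_def inv_into_into f_inv_into_f)
  have \<sigma>c: "\<sigma> a i \<in> carrier R" if "a \<in> H" for a i using c[of "\<sigma> a" I i] \<sigma>[OF that] by blast
  \<comment> \<open>This is the image of m \<otimes> v under the identification of M \<otimes> F
    with the families in \<open>M\<close> indexed by \<open>I\<close>.\<close>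
  define b where "b m v = (\<lambda>i\<in>I. v i \<odot>\<^bsub>M\<^esub> m)" for m and v :: "'b \<Rightarrow> 'a"
  have bA: "b m v \<in> carrier ?A" if "m \<in> carrier M" "v \<in> carrier ?F" for m v
    using that c[OF that(2)] by (auto simp: b_def)
  \<comment> \<open>The witness is the rank one endomorphism v \<mapsto> (\<Sum> l_i v_i) s(m). It
    kills \<open>k\<close> because \<Sum> l_i k_i = \<phi>(l) = 0, and its value at the i-th basis
    vector lies over l_i m.\<close>
  have bW: "b m l \<in> W" if m: "m \<in> carrier M" and l: "l \<in> carrier ?F" "\<phi> l = \<zero>\<^bsub>R\<^esub>" for m l
  proof (rule WI)
    show "(\<lambda>v. free_eval R ?R l v \<odot>\<^bsub>?F\<^esub> s m) \<in> mod_hom R ?F ?F"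
      using s[OF m] by (intro mod_hom_compose[OF free_eval_hom[OF R vR[OF l(1)]]] mod_hom_smult_const[OF F]) simp
    show "free_eval R ?R l k \<odot>\<^bsub>?F\<^esub> s m = \<zero>\<^bsub>?F\<^esub>"
      using l s[OF m] dual[OF k l(1)] by (simp add: \<phi>_def)
    show "b m l = (\<lambda>i\<in>I. \<pi> (free_eval R ?R l (free_unit R i) \<odot>\<^bsub>?F\<^esub> s m))"
      using s[OF m] c[OF l(1)] free_eval_unit[OF R _ vR[OF l(1)]]
      by (auto simp: b_def fun_eq_iff mod_homD(3)[OF \<pi>])
  qed
  have diff: "\<exists>w\<in>W. b m u = b m v \<otimes>\<^bsub>?A\<^esub> w"
    if m: "m \<in> carrier M" and u: "u \<in> carrier ?F" and v: "v \<in> carrier ?F" and "\<phi> u = \<phi> v" for m u v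
  proof
    let ?l = "u \<ominus>\<^bsub>?F\<^esub> v"
    have l: "?l \<in> carrier ?F" using u v by simp
    have "\<phi> ?l = \<zero>\<^bsub>R\<^esub>" using mod_hom_minus_eq_zero[OF F R \<phi> u v] that(4) by simp
    then show "b m ?l \<in> W" using l m by (intro bW)
    have "u = v \<oplus>\<^bsub>?F\<^esub> ?l" using u v by (simp add: F.M.add_diff_cancel)
    then have "u i = v i \<oplus>\<^bsub>R\<^esub> ?l i" for i by (metis free_mod_add_apply)
    then show "b m u = b m v \<otimes>\<^bsub>?A\<^esub> b m ?l"
      using c[OF v] c[OF l] m by (auto simp: b_def fun_eq_iff M.smult_l_distr)
  qed
  note one_W = subgroup.one_closed[OF W]
  obtain \<psi> where \<psi>: "\<psi> \<in> hom (pair_group M ?H) ?A"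
    and \<psi>_of: "\<And>m a. m \<in> carrier M \<Longrightarrow> a \<in> carrier ?H \<Longrightarrow> \<psi> (frag_of (m, a)) = b m (\<sigma> a)"
    and \<psi>W: "\<And>z. z \<in> tensor_kernel R M ?H \<Longrightarrow> \<psi> z \<in> W"
  proof (rule tensor_kernel_universal[OF M modH A W, where b = "\<lambda>m a. b m (\<sigma> a)"])
    fix m a assume "m \<in> carrier M" "a \<in> carrier ?H"
    then show "b m (\<sigma> a) \<in> carrier ?A" using \<sigma> by (intro bA) auto
  next
    fix m m' a assume a: "m \<in> carrier M" "m' \<in> carrier M" "a \<in> carrier ?H"
    then have "b (m \<oplus>\<^bsub>M\<^esub> m') (\<sigma> a) = b m (\<sigma> a) \<otimes>\<^bsub>?A\<^esub> b m' (\<sigma> a)"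
      using a \<sigma>c by (auto simp: b_def fun_eq_iff M.smult_r_distr)
    then show "\<exists>w\<in>W. b (m \<oplus>\<^bsub>M\<^esub> m') (\<sigma> a) = b m (\<sigma> a) \<otimes>\<^bsub>?A\<^esub> b m' (\<sigma> a) \<otimes>\<^bsub>?A\<^esub> w"
      using a \<sigma> bA A.m_closed A.r_one by (intro bexI[OF _ one_W]) (simp del: mult_product_group one_product_group)
  next
    fix m a a' assume a: "m \<in> carrier M" "a \<in> carrier ?H" "a' \<in> carrier ?H"
    have "a \<oplus>\<^bsub>?H\<^esub> a' \<in> carrier ?H"
      using a abelian_monoid.a_closed[OF abelian_group.axioms(1)[OF module.axioms(2)[OF modH]]] by blast
    then have "\<exists>w\<in>W. b m (\<sigma> (a \<oplus>\<^bsub>?H\<^esub> a')) = b m (\<sigma> a \<oplus>\<^bsub>?F\<^esub> \<sigma> a') \<otimes>\<^bsub>?A\<^esub> w"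
      using a \<sigma> by (intro diff) (auto simp: mod_homD(2)[OF \<phi>])
    moreover have "b m (\<sigma> a \<oplus>\<^bsub>?F\<^esub> \<sigma> a') = b m (\<sigma> a) \<otimes>\<^bsub>?A\<^esub> b m (\<sigma> a')"
      using a \<sigma>c by (auto simp: b_def fun_eq_iff free_mod_add_apply M.smult_l_distr)
    ultimately show "\<exists>w\<in>W. b m (\<sigma> (a \<oplus>\<^bsub>?H\<^esub> a')) = b m (\<sigma> a) \<otimes>\<^bsub>?A\<^esub> b m (\<sigma> a') \<otimes>\<^bsub>?A\<^esub> w"
      by simp
  next
    fix r m a assume a: "r \<in> carrier R" "m \<in> carrier M" "a \<in> carrier ?H"
    have ra: "r \<odot>\<^bsub>?H\<^esub> a \<in> carrier ?H" using a module.smult_closed[OF modH] by blast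
    have "\<exists>w\<in>W. b m (r \<odot>\<^bsub>?F\<^esub> \<sigma> a) = b m (\<sigma> (r \<odot>\<^bsub>?H\<^esub> a)) \<otimes>\<^bsub>?A\<^esub> w"
      using a ra \<sigma> by (intro diff) (auto simp: mod_homD(3)[OF \<phi>])
    moreover have "b (r \<odot>\<^bsub>M\<^esub> m) (\<sigma> a) = b m (r \<odot>\<^bsub>?F\<^esub> \<sigma> a)"
      using a \<sigma>c by (auto simp: b_def fun_eq_iff free_mod_smult_apply M.smult_assoc1[symmetric] M.R.m_comm)
    ultimately show "\<exists>w\<in>W. b (r \<odot>\<^bsub>M\<^esub> m) (\<sigma> a) = b m (\<sigma> (r \<odot>\<^bsub>?H\<^esub> a)) \<otimes>\<^bsub>?A\<^esub> w" by simp
  qed (rule that)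

  have bk: "b (p i) (\<sigma> (k i)) \<in> carrier ?A" if "i \<in> I" for i
    using that p \<sigma>[OF kH[OF that]] by (intro bA) auto
  have "\<psi> z = (\<Otimes>\<^bsub>?A\<^esub>i\<in>I. \<psi> (frag_of (p i, k i)))"
    unfolding z_def using p kH by (intro hom_pair_group_sum[OF A \<psi> I]) auto
  also have "\<dots> = (\<Otimes>\<^bsub>?A\<^esub>i\<in>I. b (p i) (\<sigma> (k i)))"
    using p kH bk by (intro A.finprod_cong') (auto simp: \<psi>_of Pi_iff)
  finally have \<psi>z: "(\<Otimes>\<^bsub>?A\<^esub>i\<in>I. b (p i) (\<sigma> (k i))) \<in> W" using \<psi>W[OF zH] by simp
  \<comment> \<open>The basis vector and \<sigma>(k_i) are both \<phi>-preimages of k_i, so modulo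
    \<open>W\<close> one may replace the other. With basis vectors the product of all factors is the
    family \<open>p\<close> itself.\<close>
  have "\<exists>w\<in>W. b (p i) (free_unit R i) = b (p i) (\<sigma> (k i)) \<otimes>\<^bsub>?A\<^esub> w" if "i \<in> I" for i
    using that p \<sigma>[OF kH[OF that]] e[OF that] \<phi>_e[OF that] by (intro diff) auto
  then obtain w where w: "\<And>i. i \<in> I \<Longrightarrow> w i \<in> W"
    "\<And>i. i \<in> I \<Longrightarrow> b (p i) (free_unit R i) = b (p i) (\<sigma> (k i)) \<otimes>\<^bsub>?A\<^esub> w i" by metis
  have wA: "w i \<in> carrier ?A" if "i \<in> I" for i using w(1)[OF that] subgroup.subset[OF W] by blast
  have "(\<Otimes>\<^bsub>?A\<^esub>i\<in>J. w i) \<in> W" if "finite J" "J \<subseteq> I" for J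
    using that
  proof (induction J)
    case empty show ?case using one_W by (simp only: A.finprod_empty)
  next
    case (insert j J)
    then have "(\<Otimes>\<^bsub>?A\<^esub>i\<in>insert j J. w i) = w j \<otimes>\<^bsub>?A\<^esub> (\<Otimes>\<^bsub>?A\<^esub>i\<in>J. w i)"
      using wA by (intro A.finprod_insert) auto
    then show ?case using insert w(1) subgroup.m_closed[OF W] by (simp only: subset_insert_iff insert_subset)
  qed
  from this[OF I] have "(\<Otimes>\<^bsub>?A\<^esub>i\<in>I. w i) \<in> W" by simp
  from subgroup.m_closed[OF W \<psi>z this]
  have "(\<Otimes>\<^bsub>?A\<^esub>i\<in>I. b (p i) (\<sigma> (k i)) \<otimes>\<^bsub>?A\<^esub> w i) \<in> W"
    using bk wA by (subst A.finprod_multf) auto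
  also have "(\<Otimes>\<^bsub>?A\<^esub>i\<in>I. b (p i) (\<sigma> (k i)) \<otimes>\<^bsub>?A\<^esub> w i) = (\<Otimes>\<^bsub>?A\<^esub>i\<in>I. b (p i) (free_unit R i))"
    using w(2) bk wA A.m_closed by (intro A.finprod_cong') (auto simp del: mult_product_group)
  also have "(\<Otimes>\<^bsub>?A\<^esub>i\<in>I. b (p i) (free_unit R i)) = (\<lambda>i\<in>I. p i)"
  proof -
    have "(\<Otimes>\<^bsub>?A\<^esub>j\<in>J. b (p j) (free_unit R j)) = (\<lambda>i\<in>I. if i \<in> J then p i else \<zero>\<^bsub>M\<^esub>)"
      if "finite J" "J \<subseteq> I" for J
      using that
    proof (induction J)
      case empty then show ?case by simp
    next
      case (insert j J)
      have pj: "p i \<in> carrier M" if "i \<in> I" for i using p that by blast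
      have "(\<Otimes>\<^bsub>?A\<^esub>i\<in>insert j J. b (p i) (free_unit R i))
        = b (p j) (free_unit R j) \<otimes>\<^bsub>?A\<^esub> (\<Otimes>\<^bsub>?A\<^esub>i\<in>J. b (p i) (free_unit R i))"
        using insert pj e bA by (intro A.finprod_insert) (auto simp del: carrier_product_group)
      also have "(\<Otimes>\<^bsub>?A\<^esub>i\<in>J. b (p i) (free_unit R i)) = (\<lambda>i\<in>I. if i \<in> J then p i else \<zero>\<^bsub>M\<^esub>)"
        by (rule insert.IH) (use insert.prems in blast)
      also have "b (p j) (free_unit R j) \<otimes>\<^bsub>?A\<^esub> \<dots> = (\<lambda>i\<in>I. if i \<in> insert j J then p i else \<zero>\<^bsub>M\<^esub>)"
        using insert.hyps insert.prems pj by (auto simp: b_def free_unit_def fun_eq_iff)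
      finally show ?case .
    qed
    from this[OF I] show ?thesis by (auto simp: fun_eq_iff)
  qed
  finally have "(\<lambda>i\<in>I. p i) \<in> W" .
  then obtain T where T: "T \<in> mod_hom R ?F ?F" "T k = \<zero>\<^bsub>?F\<^esub>"
    and "(\<lambda>i\<in>I. p i) = (\<lambda>i\<in>I. \<pi> (T (free_unit R i)))"
    unfolding W_def mem_Collect_eq by (elim exE conjE) (rule that)
  then have Te: "p i = \<pi> (T (free_unit R i))" if "i \<in> I" for i using that by (metis restrict_apply)
  have "\<pi> (T v) = \<pi> v" if "v \<in> carrier ?F" for v
  proof (rule free_mod_hom_eqI[OF M mod_hom_compose[OF T(1) \<pi>] \<pi> _ that])
    fix i assume "i \<in> I"
    then show "\<pi> (T (free_unit R i)) = \<pi> (free_unit R i)"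
      using Te free_eval_unit[OF M _ p] by (simp add: \<pi>_def)
  qed
  then show ?thesis using T unfolding \<pi>_def by blast
qed

text \<open>If \<open>T\<close> kills \<open>Y\<close>, then \<open>T k\<close> is again a relation
  because \<open>T\<close> lies over \<open>M\<close>. An endomorphism \<open>U\<close> over
  \<open>M\<close> that kills \<open>T k\<close> gives the composite of \<open>T\<close> and
  \<open>U\<close>, which kills \<open>k\<close> and still kills \<open>Y\<close>.\<close>

lemma flat_kernel_retraction_finite:
  assumes flat: "flat_module R M" and I: "finite I" and p: "p \<in> I \<rightarrow> carrier M"
    and gen: "free_eval R M p ` carrier (free_mod R I) = carrier M"
    and Y: "finite Y" "Y \<subseteq> {k \<in> carrier (free_mod R I). free_eval R M p k = \<zero>\<^bsub>M\<^esub>}"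
  shows "\<exists>T\<in>mod_hom R (free_mod R I) (free_mod R I). (\<forall>k\<in>Y. T k = \<zero>\<^bsub>free_mod R I\<^esub>) \<and>
    (\<forall>v\<in>carrier (free_mod R I). free_eval R M p (T v) = free_eval R M p v)"
  using Y
proof (induction Y)
  case empty
  show ?case by (intro bexI[OF _ mod_hom_id]) simp
next
  case (insert k Y)
  let ?F = "free_mod R I" and ?\<pi> = "free_eval R M p"
  have F: "module R ?F"
    using flat by (intro module_free_mod) (simp add: flat_module_def module_def)
  obtain T where T: "T \<in> mod_hom R ?F ?F" "\<And>y. y \<in> Y \<Longrightarrow> T y = \<zero>\<^bsub>?F\<^esub>"
      "\<And>v. v \<in> carrier ?F \<Longrightarrow> ?\<pi> (T v) = ?\<pi> v"
    using insert by auto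
  have "T k \<in> carrier ?F" "?\<pi> (T k) = \<zero>\<^bsub>M\<^esub>"
    using insert.prems T mod_homD(1)[OF T(1)] by auto
  then obtain U where U: "U \<in> mod_hom R ?F ?F" "U (T k) = \<zero>\<^bsub>?F\<^esub>"
      "\<And>v. v \<in> carrier ?F \<Longrightarrow> ?\<pi> (U v) = ?\<pi> v"
    using flat_kernel_retraction[OF flat I p gen] by blast
  show ?case
    using T(2,3) U(2,3) mod_hom_zero[OF F F U(1)] mod_homD(1)[OF T(1)]
    by (intro bexI[OF _ mod_hom_compose[OF T(1) U(1)]]) auto
qed

lemma projective_of_kernel_retraction:
  assumes M: "module R M" and p: "p \<in> I \<rightarrow> carrier M"
    and gen: "free_eval R M p ` carrier (free_mod R I) = carrier M"
    and T: "T \<in> mod_hom R (free_mod R I) (free_mod R I)"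
    and T0: "\<And>k. k \<in> carrier (free_mod R I) \<Longrightarrow> free_eval R M p k = \<zero>\<^bsub>M\<^esub> \<Longrightarrow> T k = \<zero>\<^bsub>free_mod R I\<^esub>"
    and pT: "\<And>v. v \<in> carrier (free_mod R I) \<Longrightarrow> free_eval R M p (T v) = free_eval R M p v"
  shows "projective_module R M"
proof -
  let ?F = "free_mod R I"
  interpret M: module R M by fact
  have F: "module R ?F" by (rule module_free_mod[OF M.R.is_cring])
  interpret F: module R ?F by (rule F)
  define \<pi> where "\<pi> = free_eval R M p"
  have \<pi>: "\<pi> \<in> mod_hom R ?F M" unfolding \<pi>_def by (rule free_eval_hom[OF M p])
  define s where "s = inv_into (carrier ?F) \<pi>"
  have s: "s m \<in> carrier ?F \<and> \<pi> (s m) = m" if "m \<in> carrier M" for m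
    using that gen by (simp add: s_def \<pi>_def inv_into_into f_inv_into_f)
  \<comment> \<open>\<open>T\<close> is constant on the fibres of \<pi>, so \<open>T\<close> after
    the arbitrary choice \<open>s\<close> is linear although \<open>s\<close> need not be.\<close>
  have eq: "T a = T b" if a: "a \<in> carrier ?F" and b: "b \<in> carrier ?F" and "\<pi> a = \<pi> b" for a b
  proof -
    have "\<pi> (a \<ominus>\<^bsub>?F\<^esub> b) = \<zero>\<^bsub>M\<^esub>" by (rule mod_hom_minus_eq_zero[OF F M \<pi> a b]) (rule that(3))
    then have "T (a \<ominus>\<^bsub>?F\<^esub> b) = \<zero>\<^bsub>?F\<^esub>" using T0 a b by (simp add: \<pi>_def)
    then have "T (b \<oplus>\<^bsub>?F\<^esub> (a \<ominus>\<^bsub>?F\<^esub> b)) = T b"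
      using a b mod_homD(1)[OF T] by (simp add: mod_homD(2)[OF T])
    then show ?thesis using a b by (simp add: F.M.add_diff_cancel)
  qed
  have q: "(\<lambda>m. T (s m)) \<in> mod_hom R M ?F"
    unfolding mod_hom_def
  proof (intro CollectI conjI ballI funcsetI)
    fix m assume m: "m \<in> carrier M"
    then show "T (s m) \<in> carrier ?F" using s mod_homD(1)[OF T] by blast
    fix m' assume m': "m' \<in> carrier M"
    have "T (s (m \<oplus>\<^bsub>M\<^esub> m')) = T (s m \<oplus>\<^bsub>?F\<^esub> s m')"
      using m m' s by (intro eq) (auto simp: mod_homD(2)[OF \<pi>])
    then show "T (s (m \<oplus>\<^bsub>M\<^esub> m')) = T (s m) \<oplus>\<^bsub>?F\<^esub> T (s m')"
      using m m' s by (simp add: mod_homD(2)[OF T])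
  next
    fix r m assume r: "r \<in> carrier R" and m: "m \<in> carrier M"
    have "T (s (r \<odot>\<^bsub>M\<^esub> m)) = T (r \<odot>\<^bsub>?F\<^esub> s m)"
      using r m s by (intro eq) (auto simp: mod_homD(3)[OF \<pi>])
    then show "T (s (r \<odot>\<^bsub>M\<^esub> m)) = r \<odot>\<^bsub>?F\<^esub> T (s m)"
      using r m s by (simp add: mod_homD(3)[OF T])
  qed
  have "free_eval R M p (T (s m)) = m" if "m \<in> carrier M" for m
    using s[OF that] pT by (simp add: \<pi>_def)
  then show ?thesis
    unfolding projective_module_def using M lifts_through_of_section[OF M _ _ p q] by blast
qed

lemma finitely_generated_module_free_eval:
  assumes "module R M" "finitely_generated_module R M"
  obtains X where "finite X" "X \<subseteq> carrier M" "free_eval R M id ` carrier (free_mod R X) = carrier M"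
proof -
  interpret M: module R M by fact
  obtain X where X: "finite X" "X \<subseteq> carrier M"
    and span: "\<And>y. y \<in> carrier M \<Longrightarrow> \<exists>c \<in> X \<rightarrow> carrier R. y = (\<Oplus>\<^bsub>M\<^esub>x\<in>X. c x \<odot>\<^bsub>M\<^esub> x)"
    using assms(2) unfolding finitely_generated_module_def by auto
  have id: "id \<in> X \<rightarrow> carrier M" using X(2) by auto
  have "y \<in> free_eval R M id ` carrier (free_mod R X)" if y: "y \<in> carrier M" for y
  proof -
    obtain c where c: "c \<in> X \<rightarrow> carrier R" "y = (\<Oplus>\<^bsub>M\<^esub>x\<in>X. c x \<odot>\<^bsub>M\<^esub> x)" using span[OF y] by blast
    define v where "v x = (if x \<in> X then c x else \<zero>\<^bsub>R\<^esub>)" for x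
    have "finite {x. v x \<noteq> \<zero>\<^bsub>R\<^esub>}" by (rule finite_subset[OF _ X(1)]) (auto simp: v_def)
    then have v: "v \<in> carrier (free_mod R X)" using c(1) by (auto simp: free_mod_def v_def)
    have "free_eval R M id v = (\<Oplus>\<^bsub>M\<^esub>x\<in>X. v x \<odot>\<^bsub>M\<^esub> id x)"
      by (rule free_eval_superset[OF assms(1) v id X(1)]) (auto simp: v_def)
    also have "\<dots> = y"
      unfolding c(2) using c(1) X(2) by (intro M.M.finsum_cong') (auto simp: v_def)
    finally show ?thesis using v by blast
  qed
  moreover have "free_eval R M id ` carrier (free_mod R X) \<subseteq> carrier M"
    using mod_homD(1)[OF free_eval_hom[OF assms(1) id]] by auto
  ultimately have "free_eval R M id ` carrier (free_mod R X) = carrier M" by blast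
  with X show thesis by (rule that)
qed

theorem (in scalar_extension) projective_descent:
  assumes fg: "finitely_generated_module R M" and flat: "flat_module R M"
    and inj: "inj_on h (carrier R)" and proj: "projective_module S B"
  shows "projective_module R M"
proof -
  obtain I where I: "finite I" "I \<subseteq> carrier M"
    and gen: "free_eval R M id ` carrier (free_mod R I) = carrier M"
    using finitely_generated_module_free_eval[OF module_M fg] .
  have p: "id \<in> I \<rightarrow> carrier M" using I(2) by auto
  let ?F = "free_mod R I" and ?G = "free_mod S I"
  have F: "module R ?F" by (rule module_free_mod[OF M.R.is_cring])
  have G: "module S ?G" by (rule module_free_mod[OF S.is_cring])
  interpret F: module R ?F by (rule F)
  interpret G: module S ?G by (rule G)
  define \<pi> where "\<pi> = free_eval R M id"
  define \<rho> where "\<rho> = free_eval S B (\<lambda>i. pure (id i) \<one>\<^bsub>S\<^esub>)"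
  have \<pi>: "\<pi> \<in> mod_hom R ?F M" unfolding \<pi>_def by (rule free_eval_hom[OF module_M p])
  have "(\<lambda>i. pure (id i) \<one>\<^bsub>S\<^esub>) \<in> I \<rightarrow> carrier B" using I(2) by auto
  then have \<rho>: "\<rho> \<in> mod_hom S ?G B" unfolding \<rho>_def by (rule free_eval_hom[OF module_B])
  note ext = mod_homD[OF free_mod_extend[of I], simplified]
  have \<rho>_ext: "\<rho> (h \<circ> v) = pure (\<pi> v) \<one>\<^bsub>S\<^esub>" if "v \<in> carrier ?F" for v
    unfolding \<rho>_def \<pi>_def by (rule free_eval_pure_extend[OF p that])
  have "X \<in> \<rho> ` carrier ?G" if "X \<in> carrier B" for X
    using that
  proof (induction X rule: base_change_induct)
    case (pure m t)
    then obtain v where v: "v \<in> carrier ?F" "m = \<pi> v" using gen unfolding \<pi>_def by blast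
    then have "pure m t = \<rho> (t \<odot>\<^bsub>?G\<^esub> (h \<circ> v))"
      using pure ext(1) by (simp add: mod_homD(3)[OF \<rho>] \<rho>_ext smult_pure)
    then show ?case using pure v ext(1) by auto
  next
    case (diff X Y)
    then show ?case by (auto simp: mod_hom_minus(2)[OF G module_B \<rho>, symmetric])
  qed
  then have "\<rho> ` carrier ?G = carrier B" using mod_homD(1)[OF \<rho>] by blast
  moreover have "lifts_through S B ?G B" by (rule projective_module_lifts[OF proj G module_B])
  ultimately obtain l where l: "l \<in> mod_hom S B ?G" and \<rho>l: "\<And>X. X \<in> carrier B \<Longrightarrow> \<rho> (l X) = X"
    unfolding lifts_through_def using \<rho> mod_hom_id[of S B] by (metis id_apply)

  \<comment> \<open>As \<open>l\<close> is a section of \<rho>, the map w \<mapsto> w - l(\<rho>(w))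
    projects onto the kernel of \<rho>; the \<open>v i\<close> are its values on the basis and
    generate that kernel.\<close>
  define v where "v i = free_unit S i \<ominus>\<^bsub>?G\<^esub> l (\<rho> (free_unit S i))" for i
  note e = free_unit_mem[OF S.is_cring, of _ I]
  have le: "l (\<rho> (free_unit S i)) \<in> carrier ?G" if "i \<in> I" for i
    using mod_homD(1)[OF l] mod_homD(1)[OF \<rho>] e[OF that] by blast
  have v: "v i \<in> carrier ?G" "\<rho> (v i) = \<zero>\<^bsub>B\<^esub>" if "i \<in> I" for i
  proof -
    show "v i \<in> carrier ?G" using e[OF that] le[OF that] by (simp add: v_def)
    show "\<rho> (v i) = \<zero>\<^bsub>B\<^esub>" unfolding v_def
      by (rule mod_hom_minus_eq_zero[OF G module_B \<rho> e[OF that] le[OF that]])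
        (simp add: \<rho>l mod_homD(1)[OF \<rho> e[OF that]])
  qed
  define controls where "controls Y w \<longleftrightarrow>
    (\<forall>f\<in>mod_hom S ?G ?G. (\<forall>y\<in>Y. f (h \<circ> y) = \<zero>\<^bsub>?G\<^esub>) \<longrightarrow> f w = \<zero>\<^bsub>?G\<^esub>)" for Y w
  have "\<forall>i\<in>I. \<exists>Y. finite Y \<and> Y \<subseteq> {k \<in> carrier ?F. \<pi> k = \<zero>\<^bsub>M\<^esub>} \<and> controls Y (v i)"
    unfolding \<pi>_def controls_def
    using base_change_kernel[OF I(1) p gen v(1) v(2)[unfolded \<rho>_def]] by (rule ballI)
  then obtain Y where Y: "\<forall>i\<in>I. finite (Y i) \<and> Y i \<subseteq> {k \<in> carrier ?F. \<pi> k = \<zero>\<^bsub>M\<^esub>} \<and> controls (Y i) (v i)"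
    by (rule bchoice[THEN exE])
  have "finite (\<Union>i\<in>I. Y i)" "(\<Union>i\<in>I. Y i) \<subseteq> {k \<in> carrier ?F. free_eval R M id k = \<zero>\<^bsub>M\<^esub>}"
    using Y I(1) unfolding \<pi>_def by auto
  from flat_kernel_retraction_finite[OF flat I(1) p gen this]
  obtain T where T: "T \<in> mod_hom R ?F ?F" and TY: "\<And>i k. i \<in> I \<Longrightarrow> k \<in> Y i \<Longrightarrow> T k = \<zero>\<^bsub>?F\<^esub>"
    and \<pi>T: "\<And>v. v \<in> carrier ?F \<Longrightarrow> free_eval R M id (T v) = free_eval R M id v"
    by auto

  have u: "(\<lambda>i. h \<circ> T (free_unit R i)) \<in> I \<rightarrow> carrier ?G"
    by (intro funcsetI ext(1) mod_homD(1)[OF T] free_unit_mem[OF M.R.is_cring])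
  \<comment> \<open>\<open>U\<close> is the extension of \<open>T\<close> to \<open>S\<close>: its
    matrix is that of \<open>T\<close> with \<open>h\<close> applied to the entries.\<close>
  define U where "U = free_eval S ?G (\<lambda>i. h \<circ> T (free_unit R i))"
  have U: "U \<in> mod_hom S ?G ?G" unfolding U_def by (rule free_eval_hom[OF G u])
  have U_ext: "U (h \<circ> w) = h \<circ> T w" if "w \<in> carrier ?F" for w
  proof (rule free_mod_hom_eqI[OF module_restrict_scalars[OF M.R.is_cring h G] _ _ _ that])
    show "(\<lambda>w. U (h \<circ> w)) \<in> mod_hom R ?F (restrict_scalars h ?G)"
      by (rule mod_hom_compose[OF free_mod_extend mod_hom_restrict_scalars[OF h U]])
    show "(\<lambda>w. h \<circ> T w) \<in> mod_hom R ?F (restrict_scalars h ?G)"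
      by (rule mod_hom_compose[OF T free_mod_extend])
    show "U (h \<circ> free_unit R i) = h \<circ> T (free_unit R i)" if "i \<in> I" for i
      using free_eval_unit[OF G that u] by (simp add: U_def extend_free_unit)
  qed
  have ext0: "h \<circ> \<zero>\<^bsub>?F\<^esub> = \<zero>\<^bsub>?G\<^esub>" by (simp add: free_mod_def fun_eq_iff h_zero)
  \<comment> \<open>Since \<open>U\<close> kills every \<open>v i\<close>, it agrees with its
    composite with l \<circ> \<rho> on the basis, hence everywhere. So \<open>U\<close> vanishes
    wherever \<rho> does, and no expansion of kernel elements in the \<open>v i\<close> is
    required.\<close>
  have U_l\<rho>: "U (l (\<rho> w)) = U w" if "w \<in> carrier ?G" for w
  proof (rule free_mod_hom_eqI[OF G mod_hom_compose[OF mod_hom_compose[OF \<rho> l] U] U _ that])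
    fix i assume i: "i \<in> I"
    have "U (v i) = \<zero>\<^bsub>?G\<^esub>"
      using Y i U TY[OF i] by (fastforce simp: controls_def U_ext ext0)
    moreover have "free_unit S i = l (\<rho> (free_unit S i)) \<oplus>\<^bsub>?G\<^esub> v i"
      using e[OF i] le[OF i] by (simp add: v_def G.M.add_diff_cancel)
    ultimately show "U (l (\<rho> (free_unit S i))) = U (free_unit S i)"
      using mod_homD(2)[OF U le[OF i] v(1)[OF i]] mod_homD(1)[OF U le[OF i]] by simp
  qed
  have "T k = \<zero>\<^bsub>?F\<^esub>" if k: "k \<in> carrier ?F" and "free_eval R M id k = \<zero>\<^bsub>M\<^esub>" for k
  proof
    fix i
    have "\<rho> (h \<circ> k) = \<zero>\<^bsub>B\<^esub>"
      using \<rho>_ext[OF k] that(2) mod_hom_zero[OF module_M module_restrict_scalars[OF M.R.is_cring h module_B] pure_one_hom]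
      by (simp add: \<pi>_def)
    then have "h \<circ> T k = \<zero>\<^bsub>?G\<^esub>"
      using U_l\<rho>[OF ext(1)[OF k]] U_ext[OF k] mod_hom_zero[OF module_B G l] mod_hom_zero[OF G G U] by simp
    then have "h (T k i) = h \<zero>\<^bsub>R\<^esub>" by (simp add: fun_eq_iff free_mod_def h_zero)
    then have "T k i = \<zero>\<^bsub>R\<^esub>"
      using inj_onD[OF inj] free_mod_car(1)[OF M.R.is_cring mod_homD(1)[OF T k]] by blast
    then show "T k i = \<zero>\<^bsub>?F\<^esub> i" by (simp add: free_mod_def)
  qed
  then show ?thesis by (rule projective_of_kernel_retraction[OF module_M p gen T _ \<pi>T])
qed

theorem theorem3p1:
  fixes R :: "'a ring" and M :: "('a, 'm) module" and S :: "'s ring" and h :: "'a \<Rightarrow> 's"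
  assumes "cring R"
    and "module R M"
    and "finitely_generated_module R M"
    and "flat_module R M"
    and "cring S"
    and "h \<in> ring_hom R S"
    and "inj_on h (carrier R)"
  shows "projective_module R M \<longleftrightarrow> projective_module S (base_change R M S h)"
proof -
  interpret scalar_extension R M S h
    using assms by (simp add: scalar_extension_def scalar_extension_axioms_def)
  show ?thesis using projective_base_change projective_descent assms by blast
qed

end
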